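(* Let $G$ be a positive self-adjoint operator on $\mathcal H$ and let $M,N\subset B(\mathcal H)$ be von Neumann algebras. For every bounded self-adjoint $h\in B(\mathcal H)$ and every $\delta>0$ one has $\mathfrak e_{G,h}(\delta)<\infty$, and $$E>\mathfrak e_{G,h}(\delta)\quad\Longrightarrow\quad\gamma_{G,E}(h)\ge\operatorname{diam}\sigma(h)-2\delta.$$ Consequently, for every $\varepsilon>0$, $$E>\mathfrak E^{\rm edge}_{G;M,N}(\varepsilon)\quad\Longrightarrow\quad\Gamma_{G,E}(M,N)>\Gamma(M,N)-\varepsilon.$$
   Context: For bounded self-adjoint $h$, $\lambda_+(h)=\max\sigma(h)$, $\lambda_-(h)=\min\sigma(h)$. For a unit vector $\psi\in\operatorname{dom}G^{1/2}$, $\mathcal E_G(\psi)=\|G^{1/2}\psi\|^2$. For $\delta>0$, $$\mathfrak e_{G,h}(\delta):=\inf\Bigl\{\tfrac12\bigl(\mathcal E_G(\psi_+)+\mathcal E_G(\psi_-)\bigr):\ \psi_\pm\in\operatorname{dom}G^{1/2},\ \|\psi_\pm\|=1,\ \langle\psi_+,h\psi_+\rangle\ge\lambda_+(h)-\delta,\ \langle\psi_-,h\psi_-\rangle\le\lambda_-(h)+\delta\Bigr\}.$$ For $\varepsilon>0$, $\mathfrak E^{\rm edge}_{G;M,N}(\varepsilon)$ is the infimum of $\mathfrak e_{G,-i[a,b]}(\varepsilon/3)$ over self-adjoint $a\in M$, $b\in N$ with $\|a\|\le1$, $\|b\|\le1$ and $\operatorname{diam}\sigma(-i[a,b])>\Gamma(M,N)-\varepsilon/3$.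 Here, with $D_a(x):=-i[a,x]$ and $\|\cdot\|_{\mathrm{cb}}$ the completely bounded norm, $\Gamma(M,N):=\sup\|[D_a,D_b]\|_{\mathrm{cb}}$ over self-adjoint contractions $a\in M$, $b\in N$. For $E>\inf\sigma(G)$, $$\gamma_{G,E}(h):=2\sup_\rho\sqrt{\operatorname{Tr}(\rho h^2)-\operatorname{Tr}(\rho h)^2},$$ the supremum over density operators $\rho$ with $\operatorname{Tr}(G\rho)\le E$, and $\Gamma_{G,E}(M,N):=\sup\gamma_{G,E}(-i[a,b])$ over self-adjoint contractions $a\in M$, $b\in N$. *)

theory Defs
  imports "HOL-Analysis.Analysis"
begin

section \<open>Complex Hilbert spaces\<close>

text \<open>The inner product is linear in its second argument. Nonnegativity and definiteness
  follow from the corresponding properties of the norm.\<close>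

class complex_hilbert = banach +
  fixes scaleC :: "complex \<Rightarrow> 'a \<Rightarrow> 'a" (infixr "*\<^sub>C" 75)
    and cinner :: "'a \<Rightarrow> 'a \<Rightarrow> complex"
  assumes scaleC_add_right: "c *\<^sub>C (x + y) = c *\<^sub>C x + c *\<^sub>C y"
    and scaleC_add_left: "(c + d) *\<^sub>C x = c *\<^sub>C x + d *\<^sub>C x"
    and scaleC_scaleC: "c *\<^sub>C d *\<^sub>C x = (c * d) *\<^sub>C x"
    and scaleC_of_real: "complex_of_real r *\<^sub>C x = r *\<^sub>R x"
    and cinner_commute: "cinner x y = cnj (cinner y x)"
    and cinner_add_right: "cinner x (y + z) = cinner x y + cinner x z"
    and cinner_scaleC_right: "cinner x (c *\<^sub>C y) = c * cinner x y"
    and norm_eq_sqrt_cinner: "norm x = sqrt (Re (cinner x x))"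

instantiation complex :: complex_hilbert
begin

definition scaleC_complex :: "complex \<Rightarrow> complex \<Rightarrow> complex" where
  "scaleC_complex c x = c * x"

definition cinner_complex :: "complex \<Rightarrow> complex \<Rightarrow> complex" where
  "cinner_complex x y = cnj x * y"

instance
  by standard
    (auto simp: scaleC_complex_def cinner_complex_def algebra_simps scaleR_conv_of_real
      cmod_def power2_eq_square)

end

text \<open>Complete (that is, maximal) orthonormal sets; the space need not be separable.\<close>

definition orthonormal_basis :: "'a::complex_hilbert set \<Rightarrow> bool" where
  "orthonormal_basis B \<longleftrightarrow>
     (\<forall>e\<in>B. norm e = 1) \<and> (\<forall>e\<in>B. \<forall>f\<in>B. e \<noteq> f \<longrightarrow> cinner e f = 0) \<and>
     (\<forall>x. (\<forall>e\<in>B. cinner e x = 0) \<longrightarrow> x = 0)"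

definition some_onb :: "'a::complex_hilbert set" where
  "some_onb = (SOME B. orthonormal_basis B)"


section \<open>Bounded operators\<close>

definition bounded_clinear :: "('a::complex_hilbert \<Rightarrow> 'a) \<Rightarrow> bool" where
  "bounded_clinear T \<longleftrightarrow> bounded_linear T \<and> (\<forall>c x. T (c *\<^sub>C x) = c *\<^sub>C T x)"

definition self_adjoint :: "('a::complex_hilbert \<Rightarrow> 'a) \<Rightarrow> bool" where
  "self_adjoint T \<longleftrightarrow> bounded_clinear T \<and> (\<forall>x y. cinner (T x) y = cinner x (T y))"

definition spectrum :: "('a::complex_hilbert \<Rightarrow> 'a) \<Rightarrow> complex set" where
  "spectrum T = {z. \<not> (\<exists>S. bounded_clinear S \<and>
     (\<forall>x. S (T x - z *\<^sub>C x) = x) \<and> (\<forall>x. T (S x) - z *\<^sub>C S x = x))}"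

definition lambda_plus :: "('a::complex_hilbert \<Rightarrow> 'a) \<Rightarrow> real" where
  "lambda_plus h = (GREATEST r. complex_of_real r \<in> spectrum h)"

definition lambda_minus :: "('a::complex_hilbert \<Rightarrow> 'a) \<Rightarrow> real" where
  "lambda_minus h = (LEAST r. complex_of_real r \<in> spectrum h)"

definition expect :: "('a::complex_hilbert \<Rightarrow> 'a) \<Rightarrow> 'a \<Rightarrow> real" where
  "expect h \<psi> = Re (cinner \<psi> (h \<psi>))"

text \<open>\<open>icomm a x\<close> is the operator \<open>-i[a,x]\<close>; hence \<open>icomm a\<close> is the derivation \<open>D\<^sub>a\<close>.\<close>

definition icomm ::
    "('a::complex_hilbert \<Rightarrow> 'a) \<Rightarrow> ('a \<Rightarrow> 'a) \<Rightarrow> ('a \<Rightarrow> 'a)" where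
  "icomm a x = (\<lambda>v. (- \<i>) *\<^sub>C (a (x v) - x (a v)))"

text \<open>The adjoint is uniquely determined, and exists for every bounded operator.\<close>

definition cadjoint :: "('a::complex_hilbert \<Rightarrow> 'a) \<Rightarrow> ('a \<Rightarrow> 'a)" where
  "cadjoint T = (THE S. \<forall>x y. cinner (S x) y = cinner x (T y))"

definition commutant :: "('a::complex_hilbert \<Rightarrow> 'a) set \<Rightarrow> ('a \<Rightarrow> 'a) set" where
  "commutant A = {T. bounded_clinear T \<and> (\<forall>S\<in>A. T \<circ> S = S \<circ> T)}"

definition von_neumann_algebra :: "('a::complex_hilbert \<Rightarrow> 'a) set \<Rightarrow> bool" where
  "von_neumann_algebra M \<longleftrightarrow>
     (\<forall>T\<in>M. bounded_clinear T \<and> cadjoint T \<in> M) \<and> commutant (commutant M) = M"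

definition sa_contractions :: "('a::complex_hilbert \<Rightarrow> 'a) set \<Rightarrow> ('a \<Rightarrow> 'a) set" where
  "sa_contractions M = {a \<in> M. self_adjoint a \<and> onorm a \<le> 1}"


section \<open>Completely bounded norm\<close>

text \<open>All suprema and infima below are taken in the extended reals, so that \<open>Inf {} = \<infinity>\<close>.
  An \<open>n \<times> n\<close> matrix of operators is normed as an operator on the \<open>n\<close>-fold direct sum
  of the Hilbert space; only the entries with indices below \<open>n\<close> matter.\<close>

definition matrix_opnorm :: "nat \<Rightarrow> (nat \<Rightarrow> nat \<Rightarrow> 'a::complex_hilbert \<Rightarrow> 'a) \<Rightarrow> ereal" where
  "matrix_opnorm n X =
     (SUP v\<in>{v. (\<Sum>j<n. (norm (v j))\<^sup>2) \<le> 1}.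
        ereal (sqrt (\<Sum>i<n. (norm (\<Sum>j<n. X i j (v j)))\<^sup>2)))"

definition cb_norm :: "(('a::complex_hilbert \<Rightarrow> 'a) \<Rightarrow> ('a \<Rightarrow> 'a)) \<Rightarrow> ereal" where
  "cb_norm \<Phi> =
     Sup {matrix_opnorm n (\<lambda>i j. \<Phi> (X i j)) | n X.
            (\<forall>i<n. \<forall>j<n. bounded_clinear (X i j)) \<and> matrix_opnorm n X \<le> 1}"

definition Gamma_cb ::
    "('a::complex_hilbert \<Rightarrow> 'a) set \<Rightarrow> ('a \<Rightarrow> 'a) set \<Rightarrow> ereal" where
  "Gamma_cb M N =
     (SUP (a, b)\<in>sa_contractions M \<times> sa_contractions N.
        cb_norm (\<lambda>x v. icomm a (icomm b x) v - icomm b (icomm a x) v))"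


section \<open>Unbounded operators\<close>

text \<open>A possibly unbounded operator is a partial function, its \<open>dom\<close> being the operator domain.
  The last condition says that \<open>G\<close> equals its adjoint, including equality of the domains.\<close>

definition unbounded_self_adjoint :: "('a::complex_hilbert \<rightharpoonup> 'a) \<Rightarrow> bool" where
  "unbounded_self_adjoint G \<longleftrightarrow>
     (\<forall>x y u v. G x = Some u \<longrightarrow> G y = Some v \<longrightarrow> G (x + y) = Some (u + v)) \<and>
     (\<forall>c x u. G x = Some u \<longrightarrow> G (c *\<^sub>C x) = Some (c *\<^sub>C u)) \<and>
     closure (dom G) = UNIV \<and>
     (\<forall>y z. G y = Some z \<longleftrightarrow> (\<forall>x\<in>dom G. cinner (the (G x)) y = cinner x z))"

definition positive_self_adjoint :: "('a::complex_hilbert \<rightharpoonup> 'a) \<Rightarrow> bool" where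
  "positive_self_adjoint G \<longleftrightarrow>
     unbounded_self_adjoint G \<and> (\<forall>x\<in>dom G. 0 \<le> Re (cinner x (the (G x))))"

text \<open>Every positive self-adjoint operator has a unique positive self-adjoint square root,
  so the choice is immaterial. The domain of \<open>S \<circ>\<^sub>m S\<close> consists of the \<open>x\<close> in the domain
  of \<open>S\<close> for which \<open>S x\<close> is again in it.\<close>

definition op_sqrt :: "('a::complex_hilbert \<rightharpoonup> 'a) \<Rightarrow> ('a \<rightharpoonup> 'a)" where
  "op_sqrt G = (SOME S. positive_self_adjoint S \<and> S \<circ>\<^sub>m S = G)"

definition energy :: "('a::complex_hilbert \<rightharpoonup> 'a) \<Rightarrow> 'a \<Rightarrow> real" where
  "energy G \<psi> = (norm (the (op_sqrt G \<psi>)))\<^sup>2"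


section \<open>Density operators\<close>

text \<open>For trace-class operators the value does not depend on the orthonormal basis.\<close>

definition trace :: "('a::complex_hilbert \<Rightarrow> 'a) \<Rightarrow> complex" where
  "trace T = (\<Sum>\<^sub>\<infinity>e\<in>some_onb. cinner e (T e))"

text \<open>A positive operator is trace class iff its diagonal is summable.\<close>

definition density_operator :: "('a::complex_hilbert \<Rightarrow> 'a) \<Rightarrow> bool" where
  "density_operator \<rho> \<longleftrightarrow>
     self_adjoint \<rho> \<and> (\<forall>x. 0 \<le> Re (cinner x (\<rho> x))) \<and>
     (\<lambda>e. cinner e (\<rho> e)) summable_on some_onb \<and> trace \<rho> = 1"

text \<open>\<open>Tr(G\<rho>)\<close>, with values in \<open>[0,\<infinity>]\<close>, is the squared Hilbert-Schmidt norm of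
  \<open>G\<^sup>1\<^sup>/\<^sup>2\<rho>\<^sup>1\<^sup>/\<^sup>2\<close>; it is infinite if this operator is not everywhere defined.\<close>

definition energy_trace :: "('a::complex_hilbert \<rightharpoonup> 'a) \<Rightarrow> ('a \<Rightarrow> 'a) \<Rightarrow> ereal" where
  "energy_trace G \<rho> =
     (let K = op_sqrt G \<circ>\<^sub>m op_sqrt (\<lambda>x. Some (\<rho> x)) in
      if dom K = UNIV \<and> (\<lambda>e. (norm (the (K e)))\<^sup>2) summable_on some_onb
      then ereal (\<Sum>\<^sub>\<infinity>e\<in>some_onb. (norm (the (K e)))\<^sup>2) else \<infinity>)"


section \<open>Energy-constrained quantities\<close>

text \<open>The traces below are real for self-adjoint \<open>h\<close>.\<close>

definition gamma_energy ::
    "('a::complex_hilbert \<rightharpoonup> 'a) \<Rightarrow> real \<Rightarrow> ('a \<Rightarrow> 'a) \<Rightarrow> ereal" where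
  "gamma_energy G E h =
     2 * (SUP \<rho>\<in>{\<rho>. density_operator \<rho> \<and> energy_trace G \<rho> \<le> ereal E}.
            ereal (sqrt (Re (trace (\<rho> \<circ> h \<circ> h)) - (Re (trace (\<rho> \<circ> h)))\<^sup>2)))"

definition Gamma_energy ::
    "('a::complex_hilbert \<rightharpoonup> 'a) \<Rightarrow> real \<Rightarrow> ('a \<Rightarrow> 'a) set \<Rightarrow> ('a \<Rightarrow> 'a) set \<Rightarrow> ereal" where
  "Gamma_energy G E M N =
     (SUP (a, b)\<in>sa_contractions M \<times> sa_contractions N. gamma_energy G E (icomm a b))"

definition edge_energy ::
    "('a::complex_hilbert \<rightharpoonup> 'a) \<Rightarrow> ('a \<Rightarrow> 'a) \<Rightarrow> real \<Rightarrow> ereal" where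
  "edge_energy G h \<delta> =
     Inf {ereal ((energy G \<psi>\<^sub>p + energy G \<psi>\<^sub>m) / 2) | \<psi>\<^sub>p \<psi>\<^sub>m.
            \<psi>\<^sub>p \<in> dom (op_sqrt G) \<and> \<psi>\<^sub>m \<in> dom (op_sqrt G) \<and> norm \<psi>\<^sub>p = 1 \<and> norm \<psi>\<^sub>m = 1 \<and>
            expect h \<psi>\<^sub>p \<ge> lambda_plus h - \<delta> \<and> expect h \<psi>\<^sub>m \<le> lambda_minus h + \<delta>}"

definition edge_threshold ::
    "('a::complex_hilbert \<rightharpoonup> 'a) \<Rightarrow> ('a \<Rightarrow> 'a) set \<Rightarrow> ('a \<Rightarrow> 'a) set \<Rightarrow> real \<Rightarrow> ereal" where
  "edge_threshold G M N \<epsilon> =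
     Inf {edge_energy G (icomm a b) (\<epsilon> / 3) | a b.
            a \<in> sa_contractions M \<and> b \<in> sa_contractions N \<and>
            ereal (diameter (spectrum (icomm a b))) > Gamma_cb M N - ereal (\<epsilon> / 3)}"

end

theory Submission
  imports Defs
begin

text \<open>Near-optimal unit vectors for \<open>\<lambda>\<^sub>\<plusminus>(h)\<close> exist in the form domain because \<open>\<lambda>\<^sub>\<plusminus>(h)\<close> are the extreme values
  of the numerical range and \<open>dom G\<^sup>1\<^sup>/\<^sup>2\<close> is dense. The equal mixture of two such vectors \<open>\<psi>\<^sub>+\<close>, \<open>\<psi>\<^sub>-\<close>
  has the mean of the two energies as its energy, and the variance of \<open>h\<close> in it is at least
  \<open>((\<langle>\<psi>\<^sub>+, h \<psi>\<^sub>+\<rangle> - \<langle>\<psi>\<^sub>-, h \<psi>\<^sub>-\<rangle>) / 2)\<^sup>2\<close>, which gives the bound on \<open>\<gamma>\<close>. The bound on \<open>\<Gamma>\<close> then costs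
  \<open>\<epsilon>/3\<close> for the choice of \<open>a, b\<close> and \<open>2\<epsilon>/3\<close> for the two vectors.\<close>

text \<open>\<open>op_sqrt\<close> and \<open>some_onb\<close> are bare choices, so nothing can be
  said about them before existence is proved, and \<open>energy_trace\<close> takes two roots: that
  of the unbounded \<open>G\<close> and that of the density operator. The root of \<open>G\<close>
  is assembled from bounded roots of the contractions (1 + G)^-1 and 1 - (1 + G)^-1, which are
  limits of an iteration. A chosen root is handled only through being positive self-adjoint and
  squaring to the given operator, so the arguments cover every possible choice. In the same way,
  \<open>lambda_plus\<close> and \<open>lambda_minus\<close> acquire a meaning only when the extreme
  values of the numerical range are shown to lie in the spectrum. A mixture is taken rather than a
  superposition because the two vectors may fail to be orthogonal and a superposition would bring in
  cross terms of \<open>h\<close> and of the energy. Equal weights make the two-point standard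
  deviation half the gap, which the factor 2 in \<open>gamma_energy\<close> undoes. On the zero
  space there are no unit vectors, and \<open>edge_energy\<close> would be infinite; hence the
  assumption of a nonzero vector.\<close>

subsection \<open>Complex inner products\<close>

lemma cinner_zero_right [simp]: "cinner x (0::'a::complex_hilbert) = 0"
  using cinner_add_right[of x 0 0] by simp

lemma cinner_zero_left [simp]: "cinner (0::'a::complex_hilbert) x = 0"
  by (subst cinner_commute) simp

lemma cinner_add_left: "cinner (x + y) (z::'a::complex_hilbert) = cinner x z + cinner y z"
  by (metis cinner_add_right cinner_commute complex_cnj_add)

lemma cinner_scaleC_left: "cinner (c *\<^sub>C x) (y::'a::complex_hilbert) = cnj c * cinner x y"
  by (metis cinner_commute cinner_scaleC_right complex_cnj_mult)

lemma cinner_scaleR_right: "cinner x (r *\<^sub>R (y::'a::complex_hilbert)) = of_real r * cinner x y"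
  by (metis cinner_scaleC_right scaleC_of_real)

lemma cinner_scaleR_left: "cinner (r *\<^sub>R x) (y::'a::complex_hilbert) = of_real r * cinner x y"
  by (metis cinner_scaleC_left complex_cnj_complex_of_real scaleC_of_real)

lemma cinner_minus_right: "cinner x (- (y::'a::complex_hilbert)) = - cinner x y"
  using cinner_add_right[of x y "- y"] by (simp add: add_eq_0_iff)

lemma cinner_minus_left: "cinner (- x) (y::'a::complex_hilbert) = - cinner x y"
  using cinner_add_left[of x "- x" y] by (simp add: add_eq_0_iff)

lemma cinner_diff_right: "cinner x (y - (z::'a::complex_hilbert)) = cinner x y - cinner x z"
  by (simp only: diff_conv_add_uminus cinner_add_right cinner_minus_right)

lemma cinner_diff_left: "cinner (x - y) (z::'a::complex_hilbert) = cinner x z - cinner y z"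
  by (simp only: diff_conv_add_uminus cinner_add_left cinner_minus_left)

lemmas cinner_simps = cinner_add_left cinner_add_right cinner_diff_left cinner_diff_right
  cinner_minus_left cinner_minus_right cinner_scaleC_left cinner_scaleC_right
  cinner_scaleR_left cinner_scaleR_right

lemma cinner_sum_right: "cinner x (\<Sum>i\<in>A. f i) = (\<Sum>i\<in>A. cinner x (f i :: 'a::complex_hilbert))"
  by (induction A rule: infinite_finite_induct) (auto simp: cinner_add_right)

lemma cinner_sum_left: "cinner (\<Sum>i\<in>A. f i) x = (\<Sum>i\<in>A. cinner (f i :: 'a::complex_hilbert) x)"
  by (induction A rule: infinite_finite_induct) (auto simp: cinner_add_left)

lemma scaleC_zero_left [simp]: "0 *\<^sub>C (x::'a::complex_hilbert) = 0"
  using scaleC_of_real[of 0 x] by simp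

lemma scaleC_one [simp]: "1 *\<^sub>C (x::'a::complex_hilbert) = x"
  using scaleC_of_real[of 1 x] by simp

lemma scaleC_zero_right [simp]: "c *\<^sub>C (0::'a::complex_hilbert) = 0"
  using scaleC_add_right[of c 0 "0::'a"] by simp

lemma scaleC_minus_right: "c *\<^sub>C (- (x::'a::complex_hilbert)) = - (c *\<^sub>C x)"
  using scaleC_add_right[of c x "- x"] by (simp add: add_eq_0_iff)

lemma scaleC_diff_right: "c *\<^sub>C (x - (y::'a::complex_hilbert)) = c *\<^sub>C x - c *\<^sub>C y"
  by (simp only: diff_conv_add_uminus scaleC_add_right scaleC_minus_right)

lemma scaleC_minus_left: "(- c) *\<^sub>C (x::'a::complex_hilbert) = - (c *\<^sub>C x)"
  using scaleC_add_left[of c "- c" x] by (simp add: add_eq_0_iff)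

lemma scaleC_diff_left: "(c - d) *\<^sub>C (x::'a::complex_hilbert) = c *\<^sub>C x - d *\<^sub>C x"
  by (simp only: diff_conv_add_uminus scaleC_add_left scaleC_minus_left)

lemma scaleC_scaleR: "c *\<^sub>C (r *\<^sub>R (x::'a::complex_hilbert)) = r *\<^sub>R (c *\<^sub>C x)"
  by (simp only: scaleC_of_real[symmetric] scaleC_scaleC mult.commute)

lemma scaleC_sum_right: "c *\<^sub>C (\<Sum>i\<in>A. f i) = (\<Sum>i\<in>A. c *\<^sub>C (f i :: 'a::complex_hilbert))"
  by (induction A rule: infinite_finite_induct) (auto simp: scaleC_add_right)

lemma cinner_self: "cinner x x = of_real ((norm (x::'a::complex_hilbert))\<^sup>2)"
proof -
  \<comment> \<open>The real \<open>sqrt\<close> is odd, hence negative on negative reals;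
    nonnegativity of the norm therefore already excludes a negative real part.\<close>
  have "0 \<le> Re (cinner x x)"
    using norm_ge_zero[of x] unfolding norm_eq_sqrt_cinner by simp
  moreover have "Im (cinner x x) = 0"
    using arg_cong[OF cinner_commute[of x x], of Im] by simp
  ultimately show ?thesis
    by (simp add: complex_eq_iff norm_eq_sqrt_cinner)
qed

lemma power2_norm_eq_cinner: "(norm (x::'a::complex_hilbert))\<^sup>2 = Re (cinner x x)"
  by (simp add: cinner_self)

lemma norm_scaleC: "norm (c *\<^sub>C (x::'a::complex_hilbert)) = cmod c * norm x"
proof -
  have "(norm (c *\<^sub>C x))\<^sup>2 = Re (cnj c * c * cinner x x)"
    by (simp only: power2_norm_eq_cinner cinner_simps mult.assoc)
       (simp only: mult.left_commute)
  also have "cnj c * c = of_real ((cmod c)\<^sup>2)"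
    by (subst mult.commute) (rule complex_norm_square[symmetric])
  also have "Re (\<dots> * cinner x x) = (cmod c * norm x)\<^sup>2"
    by (simp add: cinner_self power_mult_distrib flip: of_real_mult of_real_power)
  finally show ?thesis by (simp add: power2_eq_iff_nonneg)
qed

lemma Re_cinner_commute: "Re (cinner x y) = Re (cinner (y::'a::complex_hilbert) x)"
  by (subst cinner_commute) simp

lemma power2_norm_add:
  "(norm (x + (y::'a::complex_hilbert)))\<^sup>2 = (norm x)\<^sup>2 + 2 * Re (cinner x y) + (norm y)\<^sup>2"
  by (simp add: power2_norm_eq_cinner cinner_simps Re_cinner_commute[of y x])

lemma power2_norm_diff:
  "(norm (x - (y::'a::complex_hilbert)))\<^sup>2 = (norm x)\<^sup>2 - 2 * Re (cinner x y) + (norm y)\<^sup>2"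
  by (simp add: power2_norm_eq_cinner cinner_simps Re_cinner_commute[of y x])

lemma cinner_Cauchy_Schwarz: "cmod (cinner x (y::'a::complex_hilbert)) \<le> norm x * norm y"
proof (cases "y = 0")
  case False
  define t where "t = cinner y x"
  define n where "n = (norm y)\<^sup>2"
  have n: "n > 0" using False by (simp add: n_def)
  have tt: "t * cnj t = of_real ((cmod t)\<^sup>2)" by (rule complex_norm_square[symmetric])
  have c: "cinner x y = cnj t" unfolding t_def by (rule cinner_commute)
  \<comment> \<open>The vector is the component of \<open>x\<close> orthogonal to \<open>y\<close>,
    multiplied by \<open>n\<close> to clear the denominator.\<close>
  have "0 \<le> (norm (n *\<^sub>R x - t *\<^sub>C y))\<^sup>2" by simp
  also have "\<dots> = n\<^sup>2 * (norm x)\<^sup>2 - 2 * n * Re (t * cnj t) + (cmod t)\<^sup>2 * n"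
    using n by (simp add: power2_norm_diff norm_scaleC cinner_simps c power_mult_distrib
        n_def[symmetric] algebra_simps)
  also have "\<dots> = n * (n * (norm x)\<^sup>2 - (cmod t)\<^sup>2)"
    unfolding tt by (simp add: algebra_simps power2_eq_square)
  finally have "(cmod t)\<^sup>2 \<le> (norm x * norm y)\<^sup>2"
    using n by (simp add: zero_le_mult_iff n_def power_mult_distrib mult.commute)
  then have "cmod t \<le> norm x * norm y" by (rule power2_le_imp_le) simp
  then show ?thesis by (simp add: c)
qed simp

text \<open>Conjugate-linearity in the first argument is invisible to real scalars, so the limit
  rules for real bilinear maps become available.\<close>

lemma bounded_bilinear_cinner: "bounded_bilinear (cinner :: 'a::complex_hilbert \<Rightarrow> 'a \<Rightarrow> complex)"
proof
  show "\<exists>K. \<forall>a b::'a. norm (cinner a b) \<le> norm a * norm b * K"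
    by (rule exI[of _ 1]) (simp add: cinner_Cauchy_Schwarz)
qed (simp_all add: cinner_simps scaleR_conv_of_real)

lemmas tendsto_cinner = bounded_bilinear.tendsto[OF bounded_bilinear_cinner]
lemmas bounded_linear_cinner_right = bounded_bilinear.bounded_linear_right[OF bounded_bilinear_cinner]

lemma Re_cinner_le: "\<bar>Re (cinner x (y::'a::complex_hilbert))\<bar> \<le> norm x * norm y"
  using cinner_Cauchy_Schwarz[of x y] abs_Re_le_cmod[of "cinner x y"] by linarith

lemma bounded_linear_scaleC: "bounded_linear (\<lambda>x::'a::complex_hilbert. c *\<^sub>C x)"
  by (rule bounded_linear_intro[where K = "cmod c"])
    (simp_all add: scaleC_add_right scaleC_scaleR norm_scaleC)

lemma cinner_eqI:
  assumes "\<And>w. cinner w x = cinner w (y::'a::complex_hilbert)"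
  shows "x = y"
proof -
  have "cinner (x - y) (x - y) = 0" by (simp add: assms cinner_diff_right[of "x - y"])
  then show ?thesis by (simp add: cinner_self)
qed

text \<open>Completeness enters here: a minimising sequence for the distance to the subspace converges.\<close>

lemma closure_eq_UNIV_if_orthocomplement_trivial:
  fixes V :: "'a::complex_hilbert set"
  assumes zero: "0 \<in> V" and add: "\<And>x y. x \<in> V \<Longrightarrow> y \<in> V \<Longrightarrow> x + y \<in> V"
    and scale: "\<And>c x. x \<in> V \<Longrightarrow> c *\<^sub>C x \<in> V"
    and triv: "\<And>x. (\<And>v. v \<in> V \<Longrightarrow> cinner v x = 0) \<Longrightarrow> x = 0"
  shows "closure V = UNIV"
proof -
  have "x \<in> closure V" for x
  proof -
    define d where "d = infdist x V"
    have V: "V \<noteq> {}" using zero by auto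
    have d0: "0 \<le> d" unfolding d_def by (rule infdist_nonneg)
    have d_le: "d \<le> norm (x - v)" if "v \<in> V" for v
      unfolding d_def using infdist_le[OF that, of x] by (simp add: dist_norm)
    have "\<exists>v\<in>V. norm (x - v) < d + 1 / real (Suc n)" for n
    proof (rule ccontr)
      assume "\<not> ?thesis"
      then have "d + 1 / real (Suc n) \<le> infdist x V"
        unfolding infdist_notempty[OF V] by (intro cINF_greatest V) (auto simp: dist_norm not_less)
      then show False by (simp add: d_def)
    qed
    then obtain v where v: "\<And>n. v n \<in> V" "\<And>n. norm (x - v n) < d + 1 / real (Suc n)"
      by metis
    have lim_d: "(\<lambda>n. norm (x - v n)) \<longlonglongrightarrow> d"
    proof (rule tendsto_sandwich[of "\<lambda>_. d" _ _ "\<lambda>n. d + 1 / real (Suc n)"])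
      show "(\<lambda>n. d + 1 / real (Suc n)) \<longlonglongrightarrow> d"
        using tendsto_add[OF tendsto_const LIMSEQ_inverse_real_of_nat, of d] by (simp add: inverse_eq_divide)
    qed (use v d_le in \<open>auto intro!: always_eventually less_imp_le simp del: of_nat_Suc\<close>)
    \<comment> \<open>Parallelogram law: the midpoint of \<open>v m\<close> and \<open>v n\<close>
      lies in \<open>V\<close>, so \<open>p + q\<close> has norm at least 2 d, which leaves little
      room for \<open>p - q\<close>.\<close>
    have par: "(norm (v m - v n))\<^sup>2 \<le> 2 * ((norm (x - v m))\<^sup>2 + (norm (x - v n))\<^sup>2 - 2 * d\<^sup>2)" for m n
    proof -
      define p where "p = x - v m"
      define q where "q = x - v n"
      have "(1/2) *\<^sub>R (v m + v n) \<in> V"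
        using scale[OF add[OF v(1)[of m] v(1)[of n]], of "of_real (1/2)"] by (simp only: scaleC_of_real)
      from d_le[OF this] have "d \<le> norm ((1/2) *\<^sub>R (p + q))"
        by (simp add: p_def q_def algebra_simps scaleR_2[symmetric] flip: scaleR_add_left)
      then have "2 * d \<le> norm (p + q)" by simp
      then have "(2 * d)\<^sup>2 \<le> (norm (p + q))\<^sup>2" by (rule power_mono) (use d0 in simp)
      moreover have "(norm (p + q))\<^sup>2 + (norm (p - q))\<^sup>2 = 2 * ((norm p)\<^sup>2 + (norm q)\<^sup>2)"
        by (simp add: power2_norm_add power2_norm_diff)
      moreover have "norm (v m - v n) = norm (p - q)" by (simp add: p_def q_def norm_minus_commute)
      ultimately show ?thesis by (simp add: p_def q_def power_mult_distrib)
    qed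
    have "Cauchy v"
    proof (rule CauchyI)
      fix e :: real assume e: "0 < e"
      have "(\<lambda>n. (norm (x - v n))\<^sup>2) \<longlonglongrightarrow> d\<^sup>2" by (intro tendsto_intros lim_d)
      then have "eventually (\<lambda>n. (norm (x - v n))\<^sup>2 < d\<^sup>2 + e\<^sup>2 / 4) sequentially"
        by (rule order_tendstoD) (use e in simp)
      then obtain N where N: "\<And>n. n \<ge> N \<Longrightarrow> (norm (x - v n))\<^sup>2 < d\<^sup>2 + e\<^sup>2 / 4"
        by (auto simp: eventually_sequentially)
      have "norm (v m - v n) < e" if "m \<ge> N" "n \<ge> N" for m n
      proof -
        have "(norm (v m - v n))\<^sup>2 < e\<^sup>2"
          using par[of m n] N[OF that(1)] N[OF that(2)] by (simp add: field_simps)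
        then show ?thesis by (rule power2_less_imp_less) (use e in simp)
      qed
      then show "\<exists>M. \<forall>m\<ge>M. \<forall>n\<ge>M. norm (v m - v n) < e" by blast
    qed
    then obtain l where l: "v \<longlonglongrightarrow> l" using Cauchy_convergent_iff convergent_def by blast
    have l_cl: "l \<in> closure V" using v(1) l by (auto simp: closure_sequential)
    have nl: "norm (x - l) = d"
      by (rule LIMSEQ_unique[OF _ lim_d]) (intro tendsto_intros l)
    have "x - l = 0"
    proof (rule triv)
      fix w assume w: "w \<in> V"
      define t where "t = cinner w (x - l)"
      \<comment> \<open>Moving from \<open>l\<close> by s t along \<open>w\<close> cannot bring it
        closer to \<open>x\<close>. Any s > 0 with s |w|^2 < 2 then forces t = 0; the summand 1
        covers \<open>w = 0\<close>.\<close>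
      define s where "s = 1 / (1 + (norm w)\<^sup>2)"
      have "d \<le> norm (x - (l + (of_real s * t) *\<^sub>C w))"
      proof (rule LIMSEQ_le_const)
        show "(\<lambda>n. norm (x - (v n + (of_real s * t) *\<^sub>C w))) \<longlonglongrightarrow> norm (x - (l + (of_real s * t) *\<^sub>C w))"
          by (intro tendsto_intros l)
        show "\<exists>N. \<forall>n\<ge>N. d \<le> norm (x - (v n + (of_real s * t) *\<^sub>C w))"
          using d_le[OF add[OF v(1) scale[OF w]]] by blast
      qed
      then have "(norm (x - l))\<^sup>2 \<le> (norm ((x - l) - (of_real s * t) *\<^sub>C w))\<^sup>2"
        unfolding nl by (intro power_mono d0) (simp add: diff_diff_add)
      also have "\<dots> = (norm (x - l))\<^sup>2 - 2 * s * Re (t * cnj t) + s\<^sup>2 * (cmod t)\<^sup>2 * (norm w)\<^sup>2"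
        by (simp only: power2_norm_diff norm_scaleC cinner_scaleC_right norm_mult power_mult_distrib
            cinner_commute[of "x - l" w] t_def[symmetric]) (simp add: mult.assoc)
      also have "Re (t * cnj t) = (cmod t)\<^sup>2"
        by (simp only: flip: complex_norm_square) simp
      finally have le: "0 \<le> s * (cmod t)\<^sup>2 * (s * (norm w)\<^sup>2 - 2)"
        by (simp add: algebra_simps power2_eq_square)
      have s0: "s > 0" by (simp add: s_def add_pos_nonneg)
      have "s * (norm w)\<^sup>2 < 1" by (simp add: s_def divide_simps add_pos_nonneg)
      with le s0 show "cinner w (x - l) = 0"
        by (auto simp: zero_le_mult_iff t_def mult_le_0_iff)
    qed
    with l_cl show ?thesis by simp
  qed
  then show ?thesis by auto
qed

lemma closed_eq_UNIV_if_orthocomplement_trivial: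
  fixes V :: "'a::complex_hilbert set"
  assumes "closed V" "0 \<in> V" "\<And>x y. x \<in> V \<Longrightarrow> y \<in> V \<Longrightarrow> x + y \<in> V"
    and "\<And>c x. x \<in> V \<Longrightarrow> c *\<^sub>C x \<in> V"
    and "\<And>x. (\<And>v. v \<in> V \<Longrightarrow> cinner v x = 0) \<Longrightarrow> x = 0"
  shows "V = UNIV"
  using closure_eq_UNIV_if_orthocomplement_trivial[OF assms(2-)] assms(1) by simp


subsection \<open>Orthonormal bases\<close>

text \<open>Zorn's lemma: a nonzero vector orthogonal to a maximal orthonormal set could be
  normalised and adjoined to it.\<close>

lemma orthonormal_basis_some_onb: "orthonormal_basis (some_onb :: 'a::complex_hilbert set)"
proof -
  define A where "A = {B::'a set. (\<forall>e\<in>B. norm e = 1) \<and> (\<forall>e\<in>B. \<forall>f\<in>B. e \<noteq> f \<longrightarrow> cinner e f = 0)}"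
  have "\<exists>M\<in>A. \<forall>X\<in>A. M \<subseteq> X \<longrightarrow> X = M"
  proof (rule subset_Zorn')
    fix C assume C: "subset.chain A C"
    then have CA: "C \<subseteq> A" by (simp add: subset.chain_def)
    have "cinner e f = 0" if "X \<in> C" "Y \<in> C" "e \<in> X" "f \<in> Y" "e \<noteq> f" for X Y e f
    proof -
      have "X \<subseteq> Y \<or> Y \<subseteq> X" using C that by (auto simp: subset_chain_def)
      then have "\<exists>Z\<in>C. e \<in> Z \<and> f \<in> Z" using that(1-4) by auto
      then obtain Z where "Z \<in> C" "e \<in> Z" "f \<in> Z" by blast
      then show ?thesis using CA \<open>e \<noteq> f\<close> by (auto simp: A_def)
    qed
    then show "\<Union>C \<in> A" using CA by (auto simp: A_def)
  qed
  then obtain B where B: "B \<in> A" and max: "\<And>X. X \<in> A \<Longrightarrow> B \<subseteq> X \<Longrightarrow> X = B" by blast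
  have "x = 0" if x: "\<forall>e\<in>B. cinner e x = 0" for x
  proof (rule ccontr)
    assume "x \<noteq> 0"
    define u where "u = sgn x"
    have nu: "norm u = 1" using \<open>x \<noteq> 0\<close> by (simp add: u_def norm_sgn)
    have eu: "cinner e u = 0" if "e \<in> B" for e
      using x that by (simp add: u_def sgn_div_norm cinner_simps)
    have ue: "cinner u e = 0" if "e \<in> B" for e
      using eu[OF that] by (subst cinner_commute) simp
    have "insert u B \<in> A" using B nu eu ue by (auto simp: A_def)
    from max[OF this] have "u \<in> B" by auto
    with eu have "cinner u u = 0" by blast
    with nu show False by (simp add: cinner_self)
  qed
  with B have "orthonormal_basis B" by (auto simp: A_def orthonormal_basis_def)
  then show ?thesis unfolding some_onb_def by (rule someI)
qed

text \<open>The partial projections \<open>P F\<close> are contractions that fix any given vector of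
  the span of \<open>B\<close> once \<open>F\<close> is large enough. Maximality of \<open>B\<close>
  makes the span dense, and the contraction bound carries convergence over to all
  \<open>x\<close>.\<close>

lemma orthonormal_basis_has_sum:
  fixes x :: "'a::complex_hilbert"
  assumes B: "orthonormal_basis B"
  shows "((\<lambda>e. cinner e x *\<^sub>C e) has_sum x) B"
proof -
  define P where "P F v = (\<Sum>e\<in>F. cinner e v *\<^sub>C e)" for F and v :: 'a
  have ip: "cinner f (P F v) = (if f \<in> F then cinner f v else 0)"
    if "finite F" "F \<subseteq> B" "f \<in> B" for F f v
  proof -
    have "cinner f (P F v) = (\<Sum>e\<in>F. if e = f then cinner f v else 0)"
      unfolding P_def cinner_sum_right
      by (rule sum.cong)
        (use B that in \<open>auto simp: orthonormal_basis_def cinner_simps cinner_self\<close>)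
    then show ?thesis using that by simp
  qed
  have P_diff: "P F (v - w) = P F v - P F w" for F v w
    by (simp add: P_def sum_subtractf[symmetric] cinner_diff_right scaleC_diff_left)
  have P_add: "P F (v + w) = P F v + P F w" for F v w
    by (simp add: P_def sum.distrib[symmetric] cinner_add_right scaleC_add_left)
  have P_scale: "P F (c *\<^sub>C v) = c *\<^sub>C P F v" for F c v
    by (simp add: P_def scaleC_sum_right cinner_simps scaleC_scaleC)
  have contr: "norm (v - P F v) \<le> norm v" if F: "finite F" "F \<subseteq> B" for F v
  proof -
    have "cinner (P F v) (v - P F v) = (\<Sum>e\<in>F. cnj (cinner e v) * (cinner e v - cinner e (P F v)))"
      by (subst (1) P_def) (simp add: cinner_sum_left cinner_simps sum_subtractf right_diff_distrib)
    also have "\<dots> = 0" by (rule sum.neutral) (use F ip[OF F] in auto)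
    finally have "(norm (P F v + (v - P F v)))\<^sup>2 = (norm (P F v))\<^sup>2 + (norm (v - P F v))\<^sup>2"
      unfolding power2_norm_add by simp
    then have "(norm (v - P F v))\<^sup>2 \<le> (norm v)\<^sup>2" by simp
    then show ?thesis by (rule power2_le_imp_le) simp
  qed
  \<comment> \<open>This is the algebraic span of \<open>B\<close>, described by the projections so
    that the set \<open>F\<close> needed later comes with each vector.\<close>
  define V where "V = {v. \<exists>F. finite F \<and> F \<subseteq> B \<and> P F v = v}"
  have mono: "P F' v = v" if "finite F'" "F \<subseteq> F'" "F' \<subseteq> B" "P F v = v" for F F' v
  proof -
    have fF: "finite F" and FB: "F \<subseteq> B" using that finite_subset by auto
    have "P F' v = P F v"
      unfolding P_def
    proof (rule sum.mono_neutral_right)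
      show "\<forall>e\<in>F' - F. cinner e v *\<^sub>C e = 0"
        using ip[OF fF FB, of _ v] that by (metis Diff_iff scaleC_zero_left subsetD)
    qed (use that in auto)
    then show ?thesis using that by simp
  qed
  have "closure V = UNIV"
  proof (rule closure_eq_UNIV_if_orthocomplement_trivial)
    show "0 \<in> V" unfolding V_def by (auto simp: P_def intro!: exI[of _ "{}"])
    show "v + w \<in> V" if vw: "v \<in> V" "w \<in> V" for v w
    proof -
      obtain F F' where "finite F" "F \<subseteq> B" "P F v = v" "finite F'" "F' \<subseteq> B" "P F' w = w"
        using vw by (auto simp: V_def)
      then show ?thesis unfolding V_def
        using mono[of "F \<union> F'" F v] mono[of "F \<union> F'" F' w]
        by (intro CollectI exI[of _ "F \<union> F'"]) (simp add: P_add)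
    qed
    show "c *\<^sub>C v \<in> V" if "v \<in> V" for c v
      using that by (auto simp: V_def P_scale)
    show "y = 0" if y: "\<And>v. v \<in> V \<Longrightarrow> cinner v y = 0" for y
    proof -
      have "e \<in> V" if "e \<in> B" for e
        using that B by (auto simp: V_def P_def orthonormal_basis_def cinner_self intro!: exI[of _ "{e}"])
      with y B show ?thesis by (auto simp: orthonormal_basis_def)
    qed
  qed
  then have cl: "x \<in> closure V" by simp
  show ?thesis unfolding has_sum_def
  proof (rule tendstoI)
    fix e :: real assume "0 < e"
    then obtain v where v: "v \<in> V" "dist v x < e"
      using cl unfolding closure_approachable by blast
    then obtain F where F: "finite F" "F \<subseteq> B" "P F v = v" by (auto simp: V_def)
    have "dist (\<Sum>e\<in>F'. cinner e x *\<^sub>C e) x < e" if F': "finite F'" "F \<subseteq> F'" "F' \<subseteq> B" for F'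
    proof -
      have "norm (x - P F' x) = norm ((x - v) - P F' (x - v))"
        using mono[OF F' F(3)] by (simp add: P_diff)
      also have "\<dots> \<le> norm (x - v)" by (rule contr[OF F'(1,3)])
      also have "\<dots> < e" using v(2) by (simp add: dist_norm norm_minus_commute)
      finally show ?thesis by (simp add: P_def dist_norm norm_minus_commute)
    qed
    then show "\<forall>\<^sub>F F' in finite_subsets_at_top B. dist (sum (\<lambda>e. cinner e x *\<^sub>C e) F') x < e"
      unfolding eventually_finite_subsets_at_top using F(1,2) by blast
  qed
qed

text \<open>The functional \<open>cinner x\<close> is applied to the expansion of \<open>y\<close>.
  Every trace below is evaluated through this identity, whichever basis was chosen.\<close>

lemma some_onb_Parseval:
  "((\<lambda>e. cinner x e * cinner e y) has_sum cinner x y) (some_onb :: 'a::complex_hilbert set)"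
  using has_sum_bounded_linear[OF bounded_linear_cinner_right
      orthonormal_basis_has_sum[OF orthonormal_basis_some_onb], of x y]
  by (simp add: o_def cinner_simps mult.commute)


subsection \<open>Bounded operators and square roots\<close>

lemma self_adjointD: "self_adjoint T \<Longrightarrow> cinner (T x) y = cinner x (T y)"
  by (simp add: self_adjoint_def)

lemma self_adjoint_linearD:
  assumes "self_adjoint T"
  shows "bounded_linear T" "T (c *\<^sub>C x) = c *\<^sub>C T x" "T (x + y) = T x + T y" "T (x - y) = T x - T y"
    "T (r *\<^sub>R x) = r *\<^sub>R T x" "T 0 = 0"
proof -
  show bl: "bounded_linear T" and "T (c *\<^sub>C x) = c *\<^sub>C T x"
    using assms by (auto simp: self_adjoint_def bounded_clinear_def)
  interpret bounded_linear T by (rule bl)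
  show "T (x + y) = T x + T y" "T (x - y) = T x - T y" "T (r *\<^sub>R x) = r *\<^sub>R T x" "T 0 = 0"
    by (rule add diff scaleR zero)+
qed

lemma self_adjointI:
  fixes T :: "'a::complex_hilbert \<Rightarrow> 'a"
  assumes "\<And>x y. T (x + y) = T x + T y" and scale: "\<And>c x. T (c *\<^sub>C x) = c *\<^sub>C T x"
    and "\<And>x. norm (T x) \<le> norm x * K" and "\<And>x y. cinner (T x) y = cinner x (T y)"
  shows "self_adjoint T"
proof -
  have "T (r *\<^sub>R x) = r *\<^sub>R T x" for r x
    using scale[of "of_real r" x] by (simp only: scaleC_of_real)
  then have "bounded_linear T" by (intro bounded_linear_intro[where K = K] assms)
  then show ?thesis using assms by (simp add: self_adjoint_def bounded_clinear_def)
qed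

lemma self_adjoint_id_diff:
  assumes "self_adjoint T"
  shows "self_adjoint (\<lambda>x. x - T x)"
proof -
  obtain K where K: "norm (T x) \<le> norm x * K" for x
    using bounded_linear.bounded[OF self_adjoint_linearD(1)[OF assms]] by blast
  have "norm (x - T x) \<le> norm x * (1 + K)" for x
    using norm_triangle_ineq4[of x "T x"] K[of x] by (simp add: algebra_simps)
  then show ?thesis
    by (intro self_adjointI[where K = "1 + K"])
      (simp_all add: self_adjoint_linearD[OF assms] self_adjointD[OF assms] cinner_simps
        scaleC_diff_right)
qed

text \<open>Fixed-point iteration for T = (X + T^2) / 2, aimed at the solution 1 - (1 - X)^(1/2).
  Every iterate is a polynomial in \<open>X\<close>.\<close>

fun sqrt_iter :: "('a::complex_hilbert \<Rightarrow> 'a) \<Rightarrow> nat \<Rightarrow> 'a \<Rightarrow> 'a" where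
  "sqrt_iter X 0 v = 0"
| "sqrt_iter X (Suc n) v = (1/2) *\<^sub>R (X v + sqrt_iter X n (sqrt_iter X n v))"

fun sqrt_iter_bound :: "nat \<Rightarrow> real" where
  "sqrt_iter_bound 0 = 0"
| "sqrt_iter_bound (Suc n) = (1 + (sqrt_iter_bound n)\<^sup>2) / 2"

text \<open>The iterates commute, so \<open>T\<^sub>n\<^sub>+\<^sub>1\<^sup>2 - T\<^sub>n\<^sup>2\<close> factors and the increments of \<open>T\<^sub>n\<close> are dominated in
  norm by those of the scalar iteration started from \<open>X = 1\<close>, which increases to \<open>1\<close>. The limit
  satisfies \<open>2 T = X + T\<^sup>2\<close>, that is, \<open>(1 - T)\<^sup>2 = 1 - X\<close>.\<close>

lemma sqrt_one_minus_contraction: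
  fixes X :: "'a::complex_hilbert \<Rightarrow> 'a"
  assumes X: "self_adjoint X" and X_contr: "\<And>x. norm (X x) \<le> norm x"
  obtains T where "self_adjoint T" "\<And>x. norm (T x) \<le> norm x"
    "\<And>x. x - T x - T (x - T x) = x - X x"
    "\<And>Z x. bounded_linear Z \<Longrightarrow> (\<And>y. Z (X y) = X (Z y)) \<Longrightarrow> Z (T x) = T (Z x)"
proof -
  define t where "t = sqrt_iter_bound"
  define U where "U = sqrt_iter X"
  have t0: "t 0 = 0" and tSuc: "t (Suc n) = (1 + (t n)\<^sup>2) / 2" for n by (simp_all add: t_def)
  have U0: "U 0 v = 0" and USuc: "U (Suc n) v = (1/2) *\<^sub>R (X v + U n (U n v))" for n v
    by (simp_all add: U_def)
  note Xlin = self_adjoint_linearD[OF X]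
  have t_nonneg: "0 \<le> t n" for n by (induction n) (simp_all add: t0 tSuc)
  have t_le1: "t n \<le> 1" for n
  proof (induction n)
    case (Suc n)
    then show ?case using power_le_one[OF t_nonneg, of n 2] by (simp add: tSuc)
  qed (simp add: t0)
  have U_add: "U n (x + y) = U n x + U n y" for n x y
    by (induction n arbitrary: x y) (simp_all add: U0 USuc Xlin algebra_simps)
  have U_scale: "U n (c *\<^sub>C x) = c *\<^sub>C U n x" for n c x
    by (induction n arbitrary: x) (simp_all add: U0 USuc Xlin scaleC_add_right scaleC_scaleR)
  have U_scaleR: "U n (r *\<^sub>R x) = r *\<^sub>R U n x" for n r x
    using U_scale[of n "of_real r" x] by (simp only: scaleC_of_real)
  have U_diff: "U n (x - y) = U n x - U n y" for n x y
    using U_add[of n "x - y" y] by (simp add: algebra_simps)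
  have U_sym: "cinner (U n x) y = cinner x (U n y)" for n x y
    by (induction n arbitrary: x y)
      (simp_all add: U0 USuc cinner_simps self_adjointD[OF X])
  have U_norm: "norm (U n x) \<le> t n * norm x" for n x
  proof (induction n arbitrary: x)
    case (Suc n)
    have "norm (U n (U n x)) \<le> t n * (t n * norm x)"
      by (rule order_trans[OF Suc mult_left_mono[OF Suc t_nonneg]])
    then show ?case
      using norm_triangle_ineq[of "X x" "U n (U n x)"] X_contr[of x]
      unfolding USuc tSuc norm_scaleR by (simp add: power2_eq_square algebra_simps)
  qed (simp add: U0 t0)
  have U_comm: "Z (U n x) = U n (Z x)"
    if "bounded_linear Z" "\<And>y. Z (X y) = X (Z y)" for Z n x
  proof -
    interpret Z: bounded_linear Z by fact
    show ?thesis
      by (induction n arbitrary: x) (simp_all add: U0 USuc Z.zero Z.scaleR Z.add that)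
  qed
  have U_bl: "bounded_linear (U n)" for n
    using U_norm[of n] by (intro bounded_linear_intro[where K = "t n"])
      (simp_all add: U_add U_scaleR mult.commute)
  have U_comm': "U m (U n x) = U n (U m x)" for m n x
    by (rule U_comm[OF U_bl]) (rule U_comm[OF Xlin(1), symmetric], simp)
  have step: "norm (U (Suc n) x - U n x) \<le> (t (Suc n) - t n) * norm x \<and> t n \<le> t (Suc n)" for n x
  proof (induction n arbitrary: x)
    case 0
    then show ?case using X_contr[of x] by (simp add: U0 USuc t0 tSuc)
  next
    case (Suc n)
    have tn: "t n \<le> t (Suc n)" using Suc by blast
    have t_eq: "t (Suc (Suc n)) - t (Suc n) = (t (Suc n) - t n) * (t (Suc n) + t n) / 2"
      unfolding tSuc[of "Suc n"] tSuc[of n] by (simp add: field_simps power2_eq_square)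
    \<comment> \<open>The induction hypothesis is applied at the vector
      \<open>U (Suc n) x + U n x\<close>, which is why \<open>x\<close> is kept arbitrary.\<close>
    have "U (Suc (Suc n)) x - U (Suc n) x =
      (1/2) *\<^sub>R (U (Suc n) (U (Suc n) x + U n x) - U n (U (Suc n) x + U n x))"
      unfolding USuc[of "Suc n"] U_add U_comm'[of n "Suc n"]
      by (subst (3) USuc) (simp add: algebra_simps)
    then have "norm (U (Suc (Suc n)) x - U (Suc n) x) \<le>
        (t (Suc n) - t n) * norm (U (Suc n) x + U n x) / 2"
      using Suc[of "U (Suc n) x + U n x"] by simp
    also have "norm (U (Suc n) x + U n x) \<le> (t (Suc n) + t n) * norm x"
      using norm_triangle_ineq[of "U (Suc n) x" "U n x"] U_norm[of "Suc n" x] U_norm[of n x]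
      by (simp add: algebra_simps)
    finally have "norm (U (Suc (Suc n)) x - U (Suc n) x) \<le>
        (t (Suc n) - t n) * ((t (Suc n) + t n) * norm x) / 2"
      using tn by (simp add: mult_left_mono divide_right_mono)
    moreover have "t (Suc n) \<le> t (Suc (Suc n))"
      using t_eq mult_nonneg_nonneg[of "t (Suc n) - t n" "t (Suc n) + t n"]
        tn t_nonneg[of n] t_nonneg[of "Suc n"] by linarith
    ultimately show ?case unfolding t_eq by (simp add: mult.assoc)
  qed
  have t_incseq: "incseq t" by (rule incseq_SucI) (use step in blast)
  have diff_le: "norm (U (n + k) x - U n x) \<le> (t (n + k) - t n) * norm x" for n k x
  proof (induction k)
    case (Suc k)
    have "norm (U (n + Suc k) x - U n x) \<le> norm (U (Suc (n + k)) x - U (n + k) x) + norm (U (n + k) x - U n x)"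
      using norm_triangle_ineq[of "U (Suc (n + k)) x - U (n + k) x" "U (n + k) x - U n x"] by simp
    also have "\<dots> \<le> (t (Suc (n + k)) - t (n + k)) * norm x + (t (n + k) - t n) * norm x"
      using step[of "n + k" x] Suc by linarith
    finally show ?case by (simp add: algebra_simps)
  qed simp
  have t_conv: "convergent t"
    by (rule Bseq_monoseq_convergent)
      (use t_nonneg t_le1 t_incseq in \<open>auto intro!: BseqI'[of _ 1] incseq_imp_monoseq\<close>)
  have U_conv: "convergent (\<lambda>n. U n x)" for x
  proof -
    have "Cauchy (\<lambda>n. U n x)"
    proof (rule CauchyI')
      fix e :: real assume e: "0 < e"
      then have "0 < e / (norm x + 1)" by (simp add: add_nonneg_pos)
      then obtain M where M: "\<And>m n. m \<ge> M \<Longrightarrow> n \<ge> M \<Longrightarrow> norm (t m - t n) < e / (norm x + 1)"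
        using convergent_Cauchy[OF t_conv] by (meson CauchyD)
      have "dist (U m x) (U n x) < e" if "M \<le> m" "m < n" for m n
      proof -
        have "dist (U m x) (U n x) \<le> (t n - t m) * norm x"
          using diff_le[of m "n - m" x] that by (simp add: dist_norm norm_minus_commute)
        also have "\<dots> \<le> (t n - t m) * (norm x + 1)"
          using incseqD[OF t_incseq, of m n] that by (intro mult_left_mono) auto
        also have "\<dots> < e"
          using M[of n m] incseqD[OF t_incseq, of m n] that by (simp add: pos_less_divide_eq add_nonneg_pos)
        finally show ?thesis .
      qed
      then show "\<exists>M. \<forall>m\<ge>M. \<forall>n>m. dist (U m x) (U n x) < e" by blast
    qed
    then show ?thesis by (rule Cauchy_convergent)
  qed
  define T where "T x = lim (\<lambda>n. U n x)" for x
  have lim: "(\<lambda>n. U n x) \<longlonglongrightarrow> T x" for x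
    unfolding T_def using U_conv convergent_LIMSEQ_iff by blast
  have U_norm': "norm (U n x) \<le> norm x" for n x
    using U_norm[of n x] mult_right_mono[OF t_le1[of n] norm_ge_zero[of x]] by simp
  have T_norm: "norm (T x) \<le> norm x" for x
    by (rule LIMSEQ_le_const2[OF tendsto_norm[OF lim]]) (use U_norm' in blast)
  have T_add: "T (x + y) = T x + T y" for x y
    by (rule LIMSEQ_unique[OF lim]) (unfold U_add, intro tendsto_intros lim)
  have T_scale: "T (c *\<^sub>C x) = c *\<^sub>C T x" for c x
    by (rule LIMSEQ_unique[OF lim])
      (unfold U_scale, rule bounded_linear.tendsto[OF bounded_linear_scaleC lim])
  have T_sym: "cinner (T x) y = cinner x (T y)" for x y
  proof (rule LIMSEQ_unique)
    show "(\<lambda>n. cinner (U n x) y) \<longlonglongrightarrow> cinner (T x) y" by (intro tendsto_cinner lim tendsto_const)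
    show "(\<lambda>n. cinner (U n x) y) \<longlonglongrightarrow> cinner x (T y)"
      unfolding U_sym by (intro tendsto_cinner lim tendsto_const)
  qed
  have sa: "self_adjoint T" by (rule self_adjointI[where K = 1]) (simp_all add: T_add T_scale T_norm T_sym)
  \<comment> \<open>Operator and argument vary together; the uniform bound \<open>U_norm'\<close>
    makes \<open>U n (U n x - T x)\<close> vanish in the limit, leaving
    \<open>U n (T x)\<close>.\<close>
  have lim2: "(\<lambda>n. U n (U n x)) \<longlonglongrightarrow> T (T x)" for x
  proof -
    have "(\<lambda>n. norm (U n x - T x)) \<longlonglongrightarrow> 0"
      using tendsto_norm[OF LIM_zero[OF lim]] by simp
    then have "(\<lambda>n. U n (U n x - T x)) \<longlonglongrightarrow> 0"
      by (rule Lim_null_comparison[rotated]) (simp add: U_norm')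
    from tendsto_add[OF this lim[of "T x"]] show ?thesis by (simp add: U_diff)
  qed
  have fix_eq: "T x = (1/2) *\<^sub>R (X x + T (T x))" for x
  proof (rule LIMSEQ_unique)
    show "(\<lambda>n. U (Suc n) x) \<longlonglongrightarrow> T x" by (rule LIMSEQ_Suc[OF lim])
    show "(\<lambda>n. U (Suc n) x) \<longlonglongrightarrow> (1/2) *\<^sub>R (X x + T (T x))"
      unfolding USuc by (intro tendsto_intros lim2)
  qed
  have "T x + T x = X x + T (T x)" for x
    using arg_cong[OF fix_eq[of x], of "scaleR 2"] by (simp add: scaleR_2)
  then have "x - T x - T (x - T x) = x - X x" for x
    by (simp add: self_adjoint_linearD[OF sa] algebra_simps)
  moreover have "Z (T x) = T (Z x)"
    if Z: "bounded_linear Z" "\<And>y. Z (X y) = X (Z y)" for Z x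
  proof (rule LIMSEQ_unique)
    show "(\<lambda>n. Z (U n x)) \<longlonglongrightarrow> Z (T x)" by (rule bounded_linear.tendsto[OF Z(1) lim])
    show "(\<lambda>n. Z (U n x)) \<longlonglongrightarrow> T (Z x)" unfolding U_comm[OF Z] by (rule lim)
  qed
  ultimately show thesis using that sa T_norm by blast
qed

text \<open>\<open>sqrt_one_minus_contraction\<close> delivers its roots in the form 1 - T with T a
  contraction; by Cauchy-Schwarz this form makes them positive.\<close>

lemma Re_cinner_id_diff_contraction:
  assumes "\<And>x. norm (T x) \<le> norm (x::'a::complex_hilbert)"
  shows "0 \<le> Re (cinner x (x - T x))"
proof -
  have "Re (cinner x (T x)) \<le> norm x * norm x"
    using Re_cinner_le[of x "T x"] mult_left_mono[OF assms norm_ge_zero, of x x] by linarith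
  then show ?thesis by (simp add: cinner_diff_right power2_norm_eq_cinner[symmetric] power2_eq_square)
qed


subsection \<open>Square roots of unbounded positive operators\<close>

text \<open>The last rule is the maximality half of self-adjointness: a vector that pairs with the
  graph as if it were in the domain does belong to it. Limits and orthogonality arguments enter the
  domain through this rule.\<close>

lemma unbounded_self_adjointD:
  assumes "unbounded_self_adjoint G"
  shows "G x = Some u \<Longrightarrow> G y = Some v \<Longrightarrow> G (x + y) = Some (u + v)"
    and "G x = Some u \<Longrightarrow> G (c *\<^sub>C x) = Some (c *\<^sub>C u)"
    and "closure (dom G) = UNIV"
    and "G x = Some u \<Longrightarrow> G y = Some v \<Longrightarrow> cinner u y = cinner x v"
    and "(\<And>x u. G x = Some u \<Longrightarrow> cinner u y = cinner x v) \<Longrightarrow> G y = Some v"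
proof -
  note G = assms[unfolded unbounded_self_adjoint_def]
  show "G x = Some u \<Longrightarrow> G y = Some v \<Longrightarrow> G (x + y) = Some (u + v)" using G by blast
  show "G x = Some u \<Longrightarrow> G (c *\<^sub>C x) = Some (c *\<^sub>C u)" using G by blast
  show "closure (dom G) = UNIV" using G by blast
  have iff: "G y = Some z \<longleftrightarrow> (\<forall>x\<in>dom G. cinner (the (G x)) y = cinner x z)" for y z
    using G by blast
  show "cinner u y = cinner x v" if "G x = Some u" "G y = Some v"
    using iff[of y v] that by (metis domI option.sel)
  show "G y = Some v" if "\<And>x u. G x = Some u \<Longrightarrow> cinner u y = cinner x v"
    using iff[of y v] that by auto
qed

lemma positive_self_adjointD:
  assumes "positive_self_adjoint G"
  shows "unbounded_self_adjoint G" "G x = Some u \<Longrightarrow> 0 \<le> Re (cinner x u)"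
  using assms unfolding positive_self_adjoint_def by (blast, metis domI option.sel)

text \<open>\<open>B\<close> is (1 + G)^-1. Positivity makes the cross term in |x + G x|^2
  nonnegative, so 1 + G is injective with closed range, and both \<open>B\<close> and 1 - B are
  contractions. Self-adjointness together with positivity excludes a nonzero vector orthogonal to
  the range.\<close>

lemma positive_self_adjoint_resolvent:
  fixes G :: "'a::complex_hilbert \<rightharpoonup> 'a"
  assumes G: "positive_self_adjoint G"
  obtains B where "self_adjoint B" "\<And>x. norm (B x) \<le> norm x" "\<And>x. norm (x - B x) \<le> norm x"
    "\<And>y. G (B y) = Some (y - B y)" "\<And>x u. G x = Some u \<Longrightarrow> B (x + u) = x"
proof -
  note GD = unbounded_self_adjointD[OF positive_self_adjointD(1)[OF G]]
  have norm_ge: "(norm x)\<^sup>2 + (norm u)\<^sup>2 \<le> (norm (x + u))\<^sup>2" if "G x = Some u" for x u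
    using positive_self_adjointD(2)[OF G that] by (simp add: power2_norm_add)
  have norm_ge': "norm x \<le> norm (x + u)" "norm u \<le> norm (x + u)" if "G x = Some u" for x u
  proof -
    have "(norm x)\<^sup>2 \<le> (norm (x + u))\<^sup>2" "(norm u)\<^sup>2 \<le> (norm (x + u))\<^sup>2"
      using norm_ge[OF that] zero_le_power2[of "norm x"] zero_le_power2[of "norm u"] by linarith+
    then show "norm x \<le> norm (x + u)" "norm u \<le> norm (x + u)"
      using power2_le_imp_le norm_ge_zero by blast+
  qed
  obtain x0 u0 where "G x0 = Some u0"
    using GD(3) by (metis UNIV_not_empty closure_empty domIff ex_in_conv not_None_eq)
  then have G0: "G 0 = Some 0" using GD(2)[of x0 u0 0] by simp
  have G_minus: "G (- x) = Some (- u)" if "G x = Some u" for x u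
    using GD(2)[OF that, of "-1"] by (simp add: scaleC_minus_left)
  have G_diff: "G (x - y) = Some (u - v)" if "G x = Some u" "G y = Some v" for x y u v
    using GD(1)[OF that(1) G_minus[OF that(2)]] by simp
  define V where "V = {x + u |x u. G x = Some u}"
  have "V = UNIV"
  proof (rule closed_eq_UNIV_if_orthocomplement_trivial)
    show "closed V" unfolding closed_sequential_limits
    proof (intro allI impI, elim conjE)
      fix f l assume f: "\<forall>n. f n \<in> V" and l: "f \<longlonglongrightarrow> l"
      then have "\<forall>n. \<exists>x u. f n = x + u \<and> G x = Some u" by (auto simp: V_def)
      then obtain x u where xu: "\<And>n. f n = x n + u n" "\<And>n. G (x n) = Some (u n)" by metis
      have "Cauchy x"
      proof (rule CauchyI)
        fix e :: real assume "0 < e"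
        then obtain M where M: "\<And>m n. m \<ge> M \<Longrightarrow> n \<ge> M \<Longrightarrow> norm (f m - f n) < e"
          using LIMSEQ_imp_Cauchy[OF l] by (meson CauchyD)
        have "norm (x m - x n) \<le> norm (f m - f n)" for m n
          using norm_ge'(1)[OF G_diff[OF xu(2) xu(2)], of m n] by (simp add: xu(1) algebra_simps)
        then show "\<exists>M. \<forall>m\<ge>M. \<forall>n\<ge>M. norm (x m - x n) < e" using M by (meson le_less_trans)
      qed
      then obtain y where y: "x \<longlonglongrightarrow> y" using Cauchy_convergent_iff convergent_def by blast
      have u: "u \<longlonglongrightarrow> l - y" using tendsto_diff[OF l y] by (simp add: xu(1))
      \<comment> \<open>Self-adjoint operators are closed: the pairing with any graph point
        \<open>(w, v)\<close> passes to the limit.\<close>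
      have "G y = Some (l - y)"
      proof (rule GD(5))
        fix w v assume w: "G w = Some v"
        show "cinner v y = cinner w (l - y)"
        proof (rule LIMSEQ_unique)
          show "(\<lambda>n. cinner v (x n)) \<longlonglongrightarrow> cinner v y" by (intro tendsto_cinner tendsto_const y)
          show "(\<lambda>n. cinner v (x n)) \<longlonglongrightarrow> cinner w (l - y)"
            unfolding GD(4)[OF w xu(2)] by (intro tendsto_cinner tendsto_const u)
        qed
      qed
      then have "y + (l - y) \<in> V" unfolding V_def by blast
      then show "l \<in> V" by simp
    qed
    show "0 \<in> V" using G0 unfolding V_def by force
    show "v + w \<in> V" if vw: "v \<in> V" "w \<in> V" for v w
    proof -
      obtain x u where "v = x + u" "G x = Some u" using vw(1) unfolding V_def by blast
      moreover obtain y z where "w = y + z" "G y = Some z" using vw(2) unfolding V_def by blast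
      ultimately
      show ?thesis using GD(1)[of x u y z] unfolding V_def
        by (intro CollectI exI[of _ "x + y"] exI[of _ "u + z"]) simp
    qed
    show "c *\<^sub>C v \<in> V" if v: "v \<in> V" for c v
    proof -
      obtain x u where "v = x + u" "G x = Some u" using v unfolding V_def by blast
      then show ?thesis using GD(2)[of x u c] unfolding V_def
        by (intro CollectI exI[of _ "c *\<^sub>C x"] exI[of _ "c *\<^sub>C u"]) (simp add: scaleC_add_right)
    qed
    show "y = 0" if y: "\<And>v. v \<in> V \<Longrightarrow> cinner v y = 0" for y
    proof -
      \<comment> \<open>Orthogonality to every x + G x is the adjoint relation with value
        \<open>- y\<close> at \<open>y\<close>. Then <y, G y> = -|y|^2, which positivity allows only
        for y = 0.\<close>
      have "G y = Some (- y)"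
      proof (rule GD(5))
        fix x u assume "G x = Some u"
        then have "cinner (x + u) y = 0" using y by (auto simp: V_def)
        then show "cinner u y = cinner x (- y)"
          by (simp add: cinner_simps add_eq_0_iff)
      qed
      from positive_self_adjointD(2)[OF G this] show ?thesis
        by (simp add: cinner_minus_right cinner_self flip: of_real_power)
    qed
  qed
  have "\<exists>x. G x = Some (y - x)" for y
  proof -
    have "y \<in> V" using \<open>V = UNIV\<close> by simp
    then obtain x u where "y = x + u" "G x = Some u" unfolding V_def by blast
    then show ?thesis by (intro exI[of _ x]) simp
  qed
  then obtain B where B: "\<And>y. G (B y) = Some (y - B y)" by metis
  have B_eq: "B (x + u) = x" if "G x = Some u" for x u
    using norm_ge'(1)[OF G_diff[OF B[of "x + u"] that]] by simp
  have B_add: "B (x + y) = B x + B y" for x y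
    using B_eq[OF GD(1)[OF B[of x] B[of y]]] by simp
  have B_scale: "B (c *\<^sub>C x) = c *\<^sub>C B x" for c x
    using B_eq[OF GD(2)[OF B[of x], of c]] by (simp flip: scaleC_add_right)
  have B_norm: "norm (B x) \<le> norm x" "norm (x - B x) \<le> norm x" for x
    using norm_ge'[OF B[of x]] by simp_all
  have B_sym: "cinner (B x) y = cinner x (B y)" for x y
    using GD(4)[OF B[of x] B[of y]] by (simp add: cinner_simps)
  have "self_adjoint B"
    by (rule self_adjointI[where K = 1]) (simp_all add: B_add B_scale B_norm B_sym)
  then show thesis using that B_norm B B_eq by blast
qed

text \<open>With \<open>b = (1 + G)\<^sup>-\<^sup>1\<^sup>/\<^sup>2\<close> and \<open>c = (1 - (1 + G)\<^sup>-\<^sup>1)\<^sup>1\<^sup>/\<^sup>2\<close>, the root is \<open>c b\<^sup>-\<^sup>1\<close>, with graph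
  \<open>{(b x, c x)}\<close>. Its adjoint has graph \<open>{(y, z). c y = b z}\<close>, and the two agree because
  \<open>b\<^sup>2 + c\<^sup>2 = 1\<close>: take \<open>x = b y + c z\<close>.\<close>

lemma positive_self_adjoint_sqrt_exists:
  fixes G :: "'a::complex_hilbert \<rightharpoonup> 'a"
  assumes G: "positive_self_adjoint G"
  shows "\<exists>S. positive_self_adjoint S \<and> S \<circ>\<^sub>m S = G"
proof -
  note GD = unbounded_self_adjointD[OF positive_self_adjointD(1)[OF G]]
  obtain B where B: "self_adjoint B" "\<And>x. norm (B x) \<le> norm x" "\<And>x. norm (x - B x) \<le> norm x"
    and GB: "\<And>y. G (B y) = Some (y - B y)" and BG: "\<And>x u. G x = Some u \<Longrightarrow> B (x + u) = x"
    using positive_self_adjoint_resolvent[OF G] by blast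
  note Blin = self_adjoint_linearD[OF B(1)]
  obtain Tb where Tb: "self_adjoint Tb" "\<And>x. norm (Tb x) \<le> norm x"
    and b_sq: "\<And>x. x - Tb x - Tb (x - Tb x) = x - (x - B x)"
    and Tb_comm: "\<And>Z x. bounded_linear Z \<Longrightarrow> (\<And>y. Z (y - B y) = Z y - B (Z y)) \<Longrightarrow> Z (Tb x) = Tb (Z x)"
    by (rule sqrt_one_minus_contraction[OF self_adjoint_id_diff[OF B(1)] B(3)]) blast+
  obtain Tc where Tc: "self_adjoint Tc" "\<And>x. norm (Tc x) \<le> norm x"
    and c_sq: "\<And>x. x - Tc x - Tc (x - Tc x) = x - B x"
    and Tc_comm: "\<And>Z x. bounded_linear Z \<Longrightarrow> (\<And>y. Z (B y) = B (Z y)) \<Longrightarrow> Z (Tc x) = Tc (Z x)"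
    by (rule sqrt_one_minus_contraction[OF B(1,2)]) blast+
  \<comment> \<open>The extra root d = b^(1/2) yields positivity of \<open>S\<close>: <b w, c w> =
    <d w, c (d w)>, and c is positive.\<close>
  obtain Td where Td: "self_adjoint Td" "\<And>x. norm (Td x) \<le> norm x"
    and d_sq: "\<And>x. x - Td x - Td (x - Td x) = x - Tb x"
    and Td_comm: "\<And>Z x. bounded_linear Z \<Longrightarrow> (\<And>y. Z (Tb y) = Tb (Z y)) \<Longrightarrow> Z (Td x) = Td (Z x)"
    by (rule sqrt_one_minus_contraction[OF Tb]) blast+
  define b where "b x = x - Tb x" for x
  define c where "c x = x - Tc x" for x
  define d where "d x = x - Td x" for x
  have b: "self_adjoint b" and c: "self_adjoint c" and d: "self_adjoint d"
    unfolding b_def c_def d_def using self_adjoint_id_diff Tb(1) Tc(1) Td(1) by blast+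
  note blin = self_adjoint_linearD[OF b] and clin = self_adjoint_linearD[OF c]
  have bb: "b (b x) = B x" and cc: "c (c x) = x - B x" and dd: "d (d x) = b x" for x
    using b_sq[of x] c_sq[of x] d_sq[of x] by (simp_all add: b_def c_def d_def)
  \<comment> \<open>A root commutes with whatever commutes with its radicand. This is passed on in a
    chain: from \<open>B\<close> to \<open>Tb\<close>, then to \<open>Tc\<close>, then to
    \<open>Td\<close>.\<close>
  have B_Tb: "B (Tb x) = Tb (B x)" for x
    by (rule Tb_comm[OF Blin(1)]) (simp add: Blin)
  have Tb_Tc: "Tb (Tc x) = Tc (Tb x)" for x
    by (rule Tc_comm[OF self_adjoint_linearD(1)[OF Tb(1)] B_Tb[symmetric]])
  have Tc_Td: "Tc (Td x) = Td (Tc x)" for x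
    by (rule Td_comm[OF self_adjoint_linearD(1)[OF Tc(1)] Tb_Tc[symmetric]])
  have bc: "b (c x) = c (b x)" for x
    by (simp add: b_def c_def self_adjoint_linearD[OF Tb(1)] self_adjoint_linearD[OF Tc(1)] Tb_Tc)
  have cd: "c (d x) = d (c x)" for x
    by (simp add: c_def d_def self_adjoint_linearD[OF Td(1)] self_adjoint_linearD[OF Tc(1)] Tc_Td)
  have G0: "G 0 = Some 0" using GB[of 0] by (simp add: Blin)
  have b_inj: "x = y" if "b x = b y" for x y
  proof -
    \<comment> \<open>With this, \<open>GB\<close> at \<open>x - y\<close> reads
      \<open>G 0 = Some (x - y)\<close>, while \<open>G 0 = Some 0\<close>.\<close>
    have "B (x - y) = 0" using that by (simp add: bb[symmetric] blin)
    with GB[of "x - y"] G0 show ?thesis by simp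
  qed
  have bb_cc: "b (b x) + c (c x) = x" for x by (simp add: bb cc)
  define S where "S y = (if y \<in> range b then Some (c (inv b y)) else None)" for y
  have inv_b: "inv b (b x) = x" for x by (rule inv_f_f) (auto intro: injI b_inj)
  have Sb: "S (b x) = Some (c x)" for x by (simp add: S_def inv_b)
  have dom_S: "dom S = range b" by (auto simp: S_def split: if_splits)
  have S_iff: "S y = Some z \<longleftrightarrow> (\<exists>x. y = b x \<and> z = c x)" for y z
    by (auto simp: S_def inv_b)
  have S_iff': "S y = Some z \<longleftrightarrow> c y = b z" for y z
  proof
    assume "c y = b z"
    then have "b (b y + c z) = y" using bb_cc[of y] by (simp add: blin bc flip: \<open>c y = b z\<close>)
    moreover have "c (b y + c z) = z" using bb_cc[of z] \<open>c y = b z\<close> by (simp add: clin bc[symmetric])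
    ultimately show "S y = Some z" unfolding S_iff by metis
  qed (auto simp: S_iff bc)
  have "unbounded_self_adjoint S" unfolding unbounded_self_adjoint_def
  proof (intro conjI allI impI)
    show "S (x + y) = Some (u + v)" if "S x = Some u" "S y = Some v" for x y u v
      using that by (simp add: S_iff' blin clin)
    show "S (k *\<^sub>C x) = Some (k *\<^sub>C u)" if "S x = Some u" for k x u
      using that by (simp add: S_iff' blin clin)
    have "dom G \<subseteq> dom S"
    proof
      fix x assume "x \<in> dom G"
      then obtain u where "G x = Some u" by blast
      from BG[OF this] have "x = b (b (x + u))" by (simp add: bb)
      then show "x \<in> dom S" using Sb by (metis domI)
    qed
    then show "closure (dom S) = UNIV" using closure_mono GD(3) by blast
    show "S y = Some z \<longleftrightarrow> (\<forall>x\<in>dom S. cinner (the (S x)) y = cinner x z)" for y z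
    proof -
      have "(\<forall>x\<in>dom S. cinner (the (S x)) y = cinner x z) \<longleftrightarrow> (\<forall>x. cinner (c x) y = cinner (b x) z)"
        by (simp add: dom_S Sb)
      also have "\<dots> \<longleftrightarrow> c y = b z"
        by (auto simp: self_adjointD[OF b] self_adjointD[OF c] intro: cinner_eqI)
      finally show ?thesis by (simp add: S_iff')
    qed
  qed
  moreover have "0 \<le> Re (cinner x (the (S x)))" if dom: "x \<in> dom S" for x
  proof -
    obtain w where w: "x = b w" "S x = Some (c w)" using dom Sb unfolding dom_S by blast
    have "cinner (b w) (c w) = cinner (d w) (c (d w))"
      by (simp add: dd[symmetric] self_adjointD[OF d] cd)
    then show ?thesis
      using Re_cinner_id_diff_contraction[of Tc "d w", OF Tc(2)] w by (simp add: c_def)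
  qed
  ultimately have "positive_self_adjoint S" by (simp add: positive_self_adjoint_def)
  moreover have "S \<circ>\<^sub>m S = G"
  proof
    have SS: "(S \<circ>\<^sub>m S) y = Some z \<longleftrightarrow> G y = Some z" for y z
    proof
      assume "(S \<circ>\<^sub>m S) y = Some z"
      then obtain u where "S y = Some u" "S u = Some z" by (auto simp: map_comp_Some_iff)
      then obtain x x' where x: "y = b x" "u = c x" "u = b x'" "z = c x'" by (auto simp: S_iff)
      \<comment> \<open>From c x = b x' and b^2 + c^2 = 1 one gets b w = x and c w = x', hence y =
        b^2 w = B w and z = c^2 w = w - B w.\<close>
      define w where "w = b x + c x'"
      have "b w = x" using x bb_cc[of x] by (simp add: w_def blin bc)
      moreover have "c w = x'" using x bb_cc[of x'] by (simp add: w_def clin bc[symmetric])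
      ultimately have "y = B w" "z = w - B w" using x bb cc by metis+
      then show "G y = Some z" using GB by simp
    next
      assume "G y = Some z"
      from BG[OF this] have "y = b (b (y + z))" "z = c (c (y + z))" by (simp_all add: bb cc)
      then show "(S \<circ>\<^sub>m S) y = Some z"
        unfolding map_comp_Some_iff using Sb bc by metis
    qed
    show "(S \<circ>\<^sub>m S) y = G y" for y
      using SS[of y] by (metis not_None_eq)
  qed
  ultimately show ?thesis by blast
qed

lemma op_sqrt:
  assumes "positive_self_adjoint G"
  shows "positive_self_adjoint (op_sqrt G)" "op_sqrt G \<circ>\<^sub>m op_sqrt G = G"
  using someI_ex[OF positive_self_adjoint_sqrt_exists[OF assms]] by (auto simp: op_sqrt_def)


subsection \<open>Spectra of bounded self-adjoint operators\<close>

text \<open>The bound at \<open>z\<close> gives injectivity and closed range; the bound at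
  \<open>cnj z\<close> makes the orthocomplement of the range, the kernel of h - cnj z, trivial. The
  inverse is then bounded by 1/k.\<close>

lemma not_in_spectrumI:
  fixes h :: "'a::complex_hilbert \<Rightarrow> 'a"
  assumes h: "self_adjoint h" and k: "k > 0"
    and below: "\<And>x. k * norm x \<le> norm (h x - z *\<^sub>C x)"
    and below_cnj: "\<And>x. k * norm x \<le> norm (h x - cnj z *\<^sub>C x)"
  shows "z \<notin> spectrum h"
proof -
  note hlin = self_adjoint_linearD[OF h]
  define A where "A x = h x - z *\<^sub>C x" for x
  have A_add: "A (x + y) = A x + A y" and A_scale: "A (c *\<^sub>C x) = c *\<^sub>C A x" for x y c
    by (simp_all add: A_def hlin scaleC_add_right scaleC_diff_right scaleC_scaleC mult.commute)
  have A_bl: "bounded_linear A"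
    unfolding A_def by (intro bounded_linear_sub hlin(1) bounded_linear_scaleC)
  interpret A: bounded_linear A by (rule A_bl)
  have A_below: "k * norm x \<le> norm (A x)" for x using below by (simp add: A_def)
  have "complete (A ` UNIV)"
    by (rule complete_isometric_image[OF k _ A_bl]) (auto simp: A_below complete_UNIV)
  then have "closed (range A)" by (simp add: complete_eq_closed)
  then have ran: "range A = UNIV"
  proof (rule closed_eq_UNIV_if_orthocomplement_trivial)
    show "0 \<in> range A" using A.zero by (metis rangeI)
    show "v + w \<in> range A" if "v \<in> range A" "w \<in> range A" for v w
      using that by (auto simp flip: A_add)
    show "c *\<^sub>C v \<in> range A" if "v \<in> range A" for c v
      using that by (auto simp flip: A_scale)
    show "y = 0" if y: "\<And>v. v \<in> range A \<Longrightarrow> cinner v y = 0" for y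
    proof -
      have "h y - cnj z *\<^sub>C y = 0"
      proof (rule cinner_eqI)
        fix x
        show "cinner x (h y - cnj z *\<^sub>C y) = cinner x 0"
          using y[of "A x"] by (simp add: A_def cinner_simps self_adjointD[OF h])
      qed
      then show ?thesis using below_cnj[of y] k by (simp add: mult_le_0_iff)
    qed
  qed
  have inj: "x = y" if "A x = A y" for x y
    using A_below[of "x - y"] k that by (simp add: A.diff mult_le_0_iff)
  define S where "S = inv A"
  have SA: "S (A x) = x" for x unfolding S_def by (rule inv_f_f) (auto intro: injI inj)
  have AS: "A (S x) = x" for x unfolding S_def by (rule f_inv_into_f) (simp add: ran)
  have S_scale: "S (c *\<^sub>C x) = c *\<^sub>C S x" for c x by (rule inj) (simp add: AS A_scale)
  have "bounded_linear S"
  proof (rule bounded_linear_intro[where K = "1 / k"])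
    show "S (x + y) = S x + S y" for x y by (rule inj) (simp add: AS A_add)
    show "S (c *\<^sub>R x) = c *\<^sub>R S x" for c x by (rule inj) (simp add: AS A.scaleR)
    show "norm (S x) \<le> norm x * (1 / k)" for x
      using A_below[of "S x"] k by (simp add: AS field_simps)
  qed
  then have "bounded_clinear S" by (simp add: bounded_clinear_def S_scale)
  with SA AS show ?thesis unfolding spectrum_def A_def by auto
qed

lemma self_adjoint_cinner_real:
  assumes "self_adjoint h"
  shows "cinner x (h x) = of_real (expect h x)"
proof -
  have "cinner x (h x) = cnj (cinner x (h x))"
    using self_adjointD[OF assms, of x x] cinner_commute[of "h x" x] by simp
  then show ?thesis by (simp add: expect_def complex_eq_iff)
qed

text \<open>Since <x, h x> is real, <x, (h - w) x> has imaginary part of modulus |Im w| |x|^2, so h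
  - w is bounded below by |Im w|, for w = z and for its conjugate.\<close>

lemma spectrum_self_adjoint_real:
  assumes h: "self_adjoint h" and z: "z \<in> spectrum h"
  shows "z \<in> \<real>"
proof (rule ccontr)
  assume "z \<notin> \<real>"
  then have im: "0 < \<bar>Im z\<bar>" by (simp add: complex_is_Real_iff)
  have below: "\<bar>Im w\<bar> * norm x \<le> norm (h x - w *\<^sub>C x)" for w x
  proof (cases "x = 0")
    case False
    have "cinner x (h x - w *\<^sub>C x) = of_real (expect h x) - w * of_real ((norm x)\<^sup>2)"
      by (simp add: cinner_simps self_adjoint_cinner_real[OF h] cinner_self)
    then have "\<bar>Im (cinner x (h x - w *\<^sub>C x))\<bar> = \<bar>Im w\<bar> * (norm x)\<^sup>2"
      by (simp add: abs_mult flip: of_real_power)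
    then have "\<bar>Im w\<bar> * (norm x)\<^sup>2 \<le> norm x * norm (h x - w *\<^sub>C x)"
      using cinner_Cauchy_Schwarz[of x "h x - w *\<^sub>C x"] abs_Im_le_cmod[of "cinner x (h x - w *\<^sub>C x)"]
      by linarith
    then show ?thesis using False by (simp add: power2_eq_square mult.left_commute)
  qed simp
  have "z \<notin> spectrum h"
    by (rule not_in_spectrumI[OF h im below]) (use below[of "cnj z"] in simp)
  with z show False by contradiction
qed

text \<open>Optimal \<open>t = 1 / L\<close> in \<open>0 \<le> \<langle>x - t A x, A (x - t A x)\<rangle>\<close>.\<close>

lemma norm_positive_le:
  fixes A :: "'a::complex_hilbert \<Rightarrow> 'a"
  assumes A: "self_adjoint A" and pos: "\<And>x. 0 \<le> expect A x"
    and L: "L > 0" "\<And>x. norm (A x) \<le> norm x * L"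
  shows "(norm (A x))\<^sup>2 \<le> L * expect A x"
proof -
  note Alin = self_adjoint_linearD[OF A]
  have AA: "Re (cinner (A x) (A (A x))) \<le> L * (norm (A x))\<^sup>2"
    using Re_cinner_le[of "A x" "A (A x)"] mult_left_mono[OF L(2)[of "A x"] norm_ge_zero[of "A x"]]
    by (simp add: power2_eq_square algebra_simps)
  have "0 \<le> expect A (x - (1 / L) *\<^sub>R A x)" by (rule pos)
  also have "\<dots> = expect A x - 2 * (norm (A x))\<^sup>2 / L + Re (cinner (A x) (A (A x))) / L\<^sup>2"
    by (simp add: expect_def Alin cinner_simps cinner_self power2_eq_square
        self_adjointD[OF A, of x "A x", symmetric] add_divide_distrib diff_divide_distrib)
  also have "\<dots> \<le> expect A x - 2 * (norm (A x))\<^sup>2 / L + L * (norm (A x))\<^sup>2 / L\<^sup>2"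
    using AA L(1) by (intro add_left_mono divide_right_mono) auto
  also have "\<dots> = expect A x - (norm (A x))\<^sup>2 / L"
    using L(1) by (simp add: power2_eq_square)
  finally show ?thesis using L(1) by (simp add: field_simps)
qed

lemma expect_scaleR: "self_adjoint h \<Longrightarrow> expect h (r *\<^sub>R x) = r\<^sup>2 * expect h x"
  by (simp add: expect_def self_adjoint_linearD cinner_simps power2_eq_square)

text \<open>Let M be the supremum of the numerical range. For r > M, h - r is bounded below; M
  itself is in the spectrum because the positive operator M - h is small on near-maximisers.
  Attainment of M is what gives \<open>GREATEST\<close> its value.\<close>

lemma lambda_plus_numerical_range:
  fixes h :: "'a::complex_hilbert \<Rightarrow> 'a"
  assumes h: "self_adjoint h" and nontriv: "\<exists>x::'a. x \<noteq> 0"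
  shows "of_real (lambda_plus h) \<in> spectrum h"
    and "of_real r \<in> spectrum h \<Longrightarrow> r \<le> lambda_plus h"
    and "\<delta> > 0 \<Longrightarrow> \<exists>x. norm x = 1 \<and> expect h x > lambda_plus h - \<delta>"
proof -
  note hlin = self_adjoint_linearD[OF h]
  obtain K where K: "K > 0" "\<And>x. norm (h x) \<le> norm x * K"
    using bounded_linear.pos_bounded[OF hlin(1)] by blast
  define W where "W = {expect h x |x. norm x = 1}"
  define M where "M = Sup W"
  obtain x0 :: 'a where "x0 \<noteq> 0" using nontriv by blast
  then have ne: "W \<noteq> {}" unfolding W_def by (auto intro!: exI[of _ "sgn x0"] simp: norm_sgn)
  have "expect h x \<le> K" if "norm x = 1" for x
    using Re_cinner_le[of x "h x"] K(2)[of x] that by (simp add: expect_def)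
  then have bdd: "bdd_above W" unfolding W_def by (intro bdd_aboveI[of _ K]) auto
  have le_M1: "expect h x \<le> M" if "norm x = 1" for x
    unfolding M_def by (rule cSup_upper[OF _ bdd]) (use that in \<open>auto simp: W_def\<close>)
  have le_M: "expect h x \<le> M * (norm x)\<^sup>2" for x
  proof (cases "x = 0")
    case False
    have "expect h x = (norm x)\<^sup>2 * expect h (sgn x)"
      using False by (simp add: sgn_div_norm expect_scaleR[OF h] divide_simps)
    also have "\<dots> \<le> (norm x)\<^sup>2 * M"
      by (rule mult_left_mono[OF le_M1]) (use False in \<open>simp_all add: norm_sgn\<close>)
    finally show ?thesis by (simp add: mult.commute)
  qed (simp add: expect_def)
  have approx: "\<exists>x. norm x = 1 \<and> expect h x > M - \<delta>" if "\<delta> > 0" for \<delta>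
    using less_cSupD[OF ne, of "M - \<delta>"] that unfolding M_def[symmetric] by (auto simp: W_def)
  have upper: "r \<le> M" if "of_real r \<in> spectrum h" for r
  proof (rule ccontr)
    assume "\<not> r \<le> M"
    then have k: "r - M > 0" by simp
    have below: "(r - M) * norm x \<le> norm (h x - of_real r *\<^sub>C x)" for x
    proof (cases "x = 0")
      case False
      have "(r - M) * (norm x)\<^sup>2 \<le> - Re (cinner x (h x - of_real r *\<^sub>C x))"
        using le_M[of x] by (simp add: cinner_simps expect_def power2_norm_eq_cinner algebra_simps)
      also have "\<dots> \<le> norm x * norm (h x - of_real r *\<^sub>C x)"
        using Re_cinner_le[of x "h x - of_real r *\<^sub>C x"] by linarith
      finally show ?thesis using False by (simp add: power2_eq_square mult.left_commute)
    qed simp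
    have "of_real r \<notin> spectrum h"
      by (rule not_in_spectrumI[OF h k below]) (use below in simp)
    with that show False by contradiction
  qed
  have mem: "of_real M \<in> spectrum h"
  proof (rule ccontr)
    assume "of_real M \<notin> spectrum h"
    then obtain S where S: "bounded_clinear S" "\<And>x. S (h x - of_real M *\<^sub>C x) = x"
      unfolding spectrum_def by auto
    then obtain C where C: "C > 0" "\<And>x. norm (S x) \<le> norm x * C"
      using bounded_linear.pos_bounded unfolding bounded_clinear_def by blast
    define A where "A x = M *\<^sub>R x - h x" for x
    define L where "L = \<bar>M\<bar> + K"
    have L: "L > 0" "norm (A x) \<le> norm x * L" for x
      using K(1) norm_triangle_ineq4[of "M *\<^sub>R x" "h x"] K(2)[of x]
      by (simp_all add: L_def A_def algebra_simps add_pos_nonneg)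
    have A: "self_adjoint A"
      by (rule self_adjointI[OF _ _ L(2)])
        (simp_all add: A_def hlin self_adjointD[OF h] cinner_simps scaleC_diff_right scaleC_scaleR
          algebra_simps)
    have A_exp: "expect A x = M * (norm x)\<^sup>2 - expect h x" for x
      by (simp add: expect_def A_def cinner_simps power2_norm_eq_cinner)
    \<comment> \<open>Chosen so that a maximiser up to \<eta> has |A x|^2 < L \<eta> = 1 / C^2,
      whereas the inverse \<open>S\<close> with bound \<open>C\<close> forces |A x| to be at least 1
      / C on unit vectors.\<close>
    define \<eta> where "\<eta> = 1 / (C\<^sup>2 * L)"
    have "\<eta> > 0" using C(1) L(1) by (simp add: \<eta>_def)
    then obtain x where x: "norm x = 1" "expect h x > M - \<eta>" using approx by blast
    have "(norm (A x))\<^sup>2 \<le> L * expect A x"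
      by (rule norm_positive_le[OF A _ L]) (use le_M A_exp in simp)
    also have "\<dots> < L * \<eta>" using x L(1) by (simp add: A_exp)
    also have "\<dots> = 1 / C\<^sup>2" using L(1) by (simp add: \<eta>_def)
    finally have "(norm (A x) * C)\<^sup>2 < 1\<^sup>2"
      using C(1) by (simp add: power_mult_distrib field_simps)
    then have "norm (A x) * C < 1" by (rule power2_less_imp_less) simp
    moreover have "S (h x - M *\<^sub>R x) = x" using S(2)[of x] by (simp only: scaleC_of_real)
    then have "1 \<le> norm (A x) * C"
      using C(2)[of "h x - M *\<^sub>R x"] x(1) by (simp add: A_def norm_minus_commute)
    ultimately show False by simp
  qed
  have "lambda_plus h = M" unfolding lambda_plus_def
    using mem upper by (intro Greatest_equality)
  then show "of_real (lambda_plus h) \<in> spectrum h"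
    and "of_real r \<in> spectrum h \<Longrightarrow> r \<le> lambda_plus h"
    and "\<delta> > 0 \<Longrightarrow> \<exists>x. norm x = 1 \<and> expect h x > lambda_plus h - \<delta>"
    using mem upper approx by auto
qed

lemma spectrum_uminus_subset:
  assumes "z \<in> spectrum (\<lambda>x. - h x)"
  shows "- z \<in> spectrum h"
proof (rule ccontr)
  assume "- z \<notin> spectrum h"
  then obtain S where S: "bounded_clinear S"
    "\<And>x. S (h x - (- z) *\<^sub>C x) = x" "\<And>x. h (S x) - (- z) *\<^sub>C S x = x"
    unfolding spectrum_def by auto
  interpret bounded_linear S using S(1) by (simp add: bounded_clinear_def)
  have "bounded_clinear (\<lambda>x. - S x)"
    using S(1) bounded_linear_minus by (auto simp: bounded_clinear_def scaleC_minus_right)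
  moreover have "- S (- h x - z *\<^sub>C x) = x" for x
  proof -
    have "- h x - z *\<^sub>C x = - (h x - (- z) *\<^sub>C x)" by (simp add: scaleC_minus_left)
    then show ?thesis by (simp only: neg S(2) minus_minus)
  qed
  moreover have "- h (- S x) - z *\<^sub>C (- S x) = x" for x
  proof -
    have "- h (- S x) - z *\<^sub>C (- S x) = - (h (S (- x)) - (- z) *\<^sub>C S (- x))"
      by (simp add: neg scaleC_minus_left scaleC_minus_right)
    then show ?thesis by (simp only: S(3) minus_minus)
  qed
  ultimately have "z \<notin> spectrum (\<lambda>x. - h x)" unfolding spectrum_def by auto
  with assms show False by contradiction
qed

lemma spectrum_uminus_iff: "z \<in> spectrum (\<lambda>x. - h x) \<longleftrightarrow> - z \<in> spectrum h"
  using spectrum_uminus_subset[of z h] spectrum_uminus_subset[of "- z" "\<lambda>x. - h x"] by auto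

lemma self_adjoint_uminus:
  assumes "self_adjoint h"
  shows "self_adjoint (\<lambda>x. - h x)"
  using assms bounded_linear_minus
  by (auto simp: self_adjoint_def bounded_clinear_def scaleC_minus_right cinner_simps)

text \<open>Reflection h -> -h carries facts about the upper edge over to the lower one.\<close>

lemma lambda_minus_eq:
  fixes h :: "'a::complex_hilbert \<Rightarrow> 'a"
  assumes h: "self_adjoint h" and nontriv: "\<exists>x::'a. x \<noteq> 0"
  shows "lambda_minus h = - lambda_plus (\<lambda>x. - h x)"
  unfolding lambda_minus_def
proof (rule Least_equality)
  note lp = lambda_plus_numerical_range[OF self_adjoint_uminus[OF h] nontriv]
  show "of_real (- lambda_plus (\<lambda>x. - h x)) \<in> spectrum h"
    using lp(1) by (simp add: spectrum_uminus_iff)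
  show "- lambda_plus (\<lambda>x. - h x) \<le> y" if "of_real y \<in> spectrum h" for y
    using lp(2)[of "- y"] that by (simp add: spectrum_uminus_iff)
qed

lemma diameter_spectrum_le:
  fixes h :: "'a::complex_hilbert \<Rightarrow> 'a"
  assumes h: "self_adjoint h" and nontriv: "\<exists>x::'a. x \<noteq> 0"
  shows "diameter (spectrum h) \<le> lambda_plus h - lambda_minus h"
proof (rule diameter_le)
  show "spectrum h \<noteq> {} \<or> 0 \<le> lambda_plus h - lambda_minus h"
    using lambda_plus_numerical_range(1)[OF h nontriv] by blast
  fix z w assume zw: "z \<in> spectrum h" "w \<in> spectrum h"
  then obtain r s where rs: "z = of_real r" "w = of_real s"
    using spectrum_self_adjoint_real[OF h] by (metis Reals_cases)
  have bounds: "lambda_minus h \<le> t \<and> t \<le> lambda_plus h" if "of_real t \<in> spectrum h" for t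
    using lambda_plus_numerical_range(2)[OF h nontriv that]
      lambda_plus_numerical_range(2)[OF self_adjoint_uminus[OF h] nontriv, of "- t"] that
    by (simp add: lambda_minus_eq[OF h nontriv] spectrum_uminus_iff)
  have "\<bar>r - s\<bar> \<le> lambda_plus h - lambda_minus h"
    using bounds[of r] bounds[of s] zw unfolding rs by linarith
  then show "norm (z - w) \<le> lambda_plus h - lambda_minus h"
    unfolding rs by (simp flip: of_real_diff)
qed

text \<open>A strict inequality at a near-maximiser survives approximation from \<open>D\<close> by
  continuity of \<open>expect h\<close>; \<open>sgn\<close> restores unit length and stays in
  \<open>D\<close> by scaling.\<close>

lemma lambda_plus_approx_dense:
  fixes h :: "'a::complex_hilbert \<Rightarrow> 'a"
  assumes h: "self_adjoint h" and nontriv: "\<exists>x::'a. x \<noteq> 0" and \<delta>: "\<delta> > 0"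
    and dense: "closure D = UNIV" and scale: "\<And>c x. x \<in> D \<Longrightarrow> c *\<^sub>C x \<in> D"
  obtains x where "x \<in> D" "norm x = 1" "expect h x \<ge> lambda_plus h - \<delta>"
proof -
  obtain y where y: "norm y = 1" "expect h y > lambda_plus h - \<delta>"
    using lambda_plus_numerical_range(3)[OF h nontriv \<delta>] by blast
  have "y \<in> closure D" using dense by simp
  then obtain f where f: "\<And>n. f n \<in> D" "f \<longlonglongrightarrow> y" unfolding closure_sequential by blast
  have y0: "y \<noteq> 0" using y by auto
  have "(\<lambda>n. sgn (f n)) \<longlonglongrightarrow> sgn y" by (rule tendsto_sgn[OF f(2) y0])
  then have lim: "(\<lambda>n. sgn (f n)) \<longlonglongrightarrow> y" using y by (simp add: sgn_div_norm)
  have "(\<lambda>n. expect h (sgn (f n))) \<longlonglongrightarrow> expect h y"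
    unfolding expect_def
    by (intro tendsto_Re tendsto_cinner lim bounded_linear.tendsto[OF self_adjoint_linearD(1)[OF h]])
  then have "eventually (\<lambda>n. expect h (sgn (f n)) > lambda_plus h - \<delta>) sequentially"
    using y(2) by (rule order_tendstoD)
  moreover have "eventually (\<lambda>n. f n \<noteq> 0) sequentially"
    using f(2) y0 by (rule tendsto_imp_eventually_ne)
  ultimately obtain n where n: "expect h (sgn (f n)) > lambda_plus h - \<delta>" "f n \<noteq> 0"
    by (metis (mono_tags, lifting) eventually_conj eventually_happens trivial_limit_sequentially)
  have "sgn (f n) = of_real (inverse (norm (f n))) *\<^sub>C f n"
    by (simp only: scaleC_of_real) (simp add: sgn_div_norm)
  then have "sgn (f n) \<in> D" using scale f(1) by simp
  then show thesis using that n by (simp add: norm_sgn less_imp_le)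
qed


subsection \<open>Equal mixtures of two pure states\<close>

text \<open>In Dirac notation, (|\<psi>><\<psi>| + |\<phi>><\<phi>|) / 2.\<close>

definition mix_state :: "'a::complex_hilbert \<Rightarrow> 'a \<Rightarrow> 'a \<Rightarrow> 'a" where
  "mix_state \<psi> \<phi> x = (1/2) *\<^sub>R (cinner \<psi> x *\<^sub>C \<psi> + cinner \<phi> x *\<^sub>C \<phi>)"

lemma self_adjoint_mix_state: "self_adjoint (mix_state \<psi> \<phi>)"
proof (rule self_adjointI[where K = "(norm \<psi>)\<^sup>2 + (norm \<phi>)\<^sup>2"])
  fix x
  have "norm (mix_state \<psi> \<phi> x) \<le> norm (cinner \<psi> x *\<^sub>C \<psi> + cinner \<phi> x *\<^sub>C \<phi>)"
    by (simp add: mix_state_def)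
  also have "\<dots> \<le> cmod (cinner \<psi> x) * norm \<psi> + cmod (cinner \<phi> x) * norm \<phi>"
    by (rule norm_triangle_le) (simp add: norm_scaleC)
  also have "\<dots> \<le> norm \<psi> * norm x * norm \<psi> + norm \<phi> * norm x * norm \<phi>"
    by (intro add_mono mult_right_mono cinner_Cauchy_Schwarz) auto
  finally show "norm (mix_state \<psi> \<phi> x) \<le> norm x * ((norm \<psi>)\<^sup>2 + (norm \<phi>)\<^sup>2)"
    by (simp add: power2_eq_square algebra_simps)
next
  show "mix_state \<psi> \<phi> (x + y) = mix_state \<psi> \<phi> x + mix_state \<psi> \<phi> y" for x y
    by (simp add: mix_state_def cinner_simps scaleC_add_left scaleR_add_right)
  show "mix_state \<psi> \<phi> (c *\<^sub>C x) = c *\<^sub>C mix_state \<psi> \<phi> x" for c x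
    by (simp add: mix_state_def cinner_simps scaleC_add_right scaleC_scaleC scaleC_scaleR)
  show "cinner (mix_state \<psi> \<phi> x) y = cinner x (mix_state \<psi> \<phi> y)" for x y
    by (simp add: mix_state_def cinner_simps cinner_commute[of x \<psi>] cinner_commute[of x \<phi>] mult.commute)
qed

text \<open>Once \<open>A\<close> is moved across by symmetry, each diagonal entry is a product of
  basis coefficients, summed by Parseval. It is applied to the identity, \<open>h\<close> and the
  square of \<open>h\<close>.\<close>

lemma mix_state_has_trace:
  assumes "\<And>x y. cinner (A x) y = cinner x (A y)"
  shows "((\<lambda>e. cinner e (mix_state \<psi> \<phi> (A e))) has_sum (cinner \<psi> (A \<psi>) + cinner \<phi> (A \<phi>)) / 2) some_onb"
proof -
  have "((\<lambda>e. (cinner (A \<psi>) e * cinner e \<psi> + cinner (A \<phi>) e * cinner e \<phi>) * (1 / 2)) has_sum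
      (cinner (A \<psi>) \<psi> + cinner (A \<phi>) \<phi>) * (1 / 2)) some_onb"
    by (intro has_sum_cmult_left has_sum_add some_onb_Parseval)
  then show ?thesis by (simp add: mix_state_def cinner_simps assms)
qed

lemma mix_state_expect_nonneg: "0 \<le> Re (cinner x (mix_state \<psi> \<phi> x))"
proof -
  have "Re (cinner v x * cinner x v) = (cmod (cinner v x))\<^sup>2" for v
    by (subst (2) cinner_commute) (simp only: complex_norm_square[symmetric] Re_complex_of_real)
  then show ?thesis by (simp add: mix_state_def cinner_simps)
qed

lemma density_operator_mix_state:
  assumes "norm \<psi> = 1" "norm \<phi> = 1"
  shows "density_operator (mix_state \<psi> \<phi>)"
proof -
  have "((\<lambda>e. cinner e (mix_state \<psi> \<phi> e)) has_sum 1) some_onb"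
    using mix_state_has_trace[of "\<lambda>x. x" \<psi> \<phi>] assms by (simp add: cinner_self)
  then show ?thesis
    by (auto simp: density_operator_def trace_def self_adjoint_mix_state mix_state_expect_nonneg
        infsumI intro: has_sum_imp_summable)
qed

text \<open>This makes \<open>op_sqrt\<close> meaningful for density operators. On the full domain
  the adjoint condition reduces to symmetry, since pairings with all vectors determine a
  vector.\<close>

lemma positive_self_adjoint_total:
  fixes T :: "'a::complex_hilbert \<Rightarrow> 'a"
  assumes "self_adjoint T" "\<And>x. 0 \<le> Re (cinner x (T x))"
  shows "positive_self_adjoint (\<lambda>x. Some (T x))"
proof -
  have "dom (\<lambda>x. Some (T x)) = UNIV" by auto
  then show ?thesis
    unfolding positive_self_adjoint_def unbounded_self_adjoint_def
    using assms by (auto simp: self_adjoint_linearD self_adjointD intro: cinner_eqI)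
qed

text \<open>Any positive root \<open>R\<close> of a mixture of \<open>u\<close> and \<open>\<phi>\<close> annihilates the orthogonal complement of
  their span and hence has range in it. Expanding \<open>R\<close> in an orthonormal basis \<open>u, v\<close> of the span
  reduces the energy trace to Parseval's identity; uniqueness of \<open>R\<close> is not needed. If \<open>\<phi>\<close> is a
  multiple of \<open>u\<close>, then \<open>v = 0\<close>.\<close>

lemma energy_trace_mix_state:
  fixes G :: "'a::complex_hilbert \<rightharpoonup> 'a"
  assumes G: "positive_self_adjoint G"
    and u_dom: "u \<in> dom (op_sqrt G)" and \<phi>_dom: "\<phi> \<in> dom (op_sqrt G)" and u1: "norm u = 1"
  shows "energy_trace G (mix_state u \<phi>) = ereal ((energy G u + energy G \<phi>) / 2)"
proof -
  define S where "S = op_sqrt G"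
  define \<rho> where "\<rho> = mix_state u \<phi>"
  define R where "R = op_sqrt (\<lambda>x. Some (\<rho> x))"
  define r where "r x = the (R x)" for x
  note SD = unbounded_self_adjointD[OF positive_self_adjointD(1)[OF op_sqrt(1)[OF G]], folded S_def]
  have \<rho>: "positive_self_adjoint (\<lambda>x. Some (\<rho> x))"
    unfolding \<rho>_def by (intro positive_self_adjoint_total self_adjoint_mix_state mix_state_expect_nonneg)
  note RD = unbounded_self_adjointD[OF positive_self_adjointD(1)[OF op_sqrt(1)[OF \<rho>]], folded R_def]
  have RR: "(R \<circ>\<^sub>m R) x = Some (\<rho> x)" for x
    using op_sqrt(2)[OF \<rho>] unfolding R_def by metis
  have R: "R x = Some (r x)" and rr: "r (r x) = \<rho> x" for x
    using RR[of x] by (auto simp: map_comp_Some_iff r_def)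
  have r_sym: "cinner (r x) y = cinner x (r y)" for x y by (rule RD(4)[OF R R])
  have r_cinner: "cinner (r x) (r y) = cinner x (\<rho> y)" for x y by (simp add: r_sym rr)
  define \<alpha> where "\<alpha> = cinner u \<phi>"
  define w where "w = \<phi> - \<alpha> *\<^sub>C u"
  \<comment> \<open>Gram-Schmidt; since \<open>inverse 0 = 0\<close>, a vanishing \<open>w\<close>
    gives \<open>v = 0\<close> instead of an undefined vector.\<close>
  define v where "v = of_real (inverse (norm w)) *\<^sub>C w"
  define \<beta> where "\<beta> = cinner v \<phi>"
  have uu: "cinner u u = 1" using u1 by (simp add: cinner_self)
  have uw: "cinner u w = 0" by (simp add: w_def cinner_simps uu \<alpha>_def)
  then have wu: "cinner w u = 0" using cinner_commute[of w u] by simp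
  have uv: "cinner u v = 0" by (simp add: v_def cinner_simps uw)
  have vu: "cinner v u = 0" using uv cinner_commute[of v u] by simp
  have wv: "w = of_real (norm w) *\<^sub>C v" by (cases "w = 0") (simp_all add: v_def scaleC_scaleC)
  have \<phi>w: "\<phi> = \<alpha> *\<^sub>C u + w" by (simp add: w_def)
  have "\<beta> = of_real (norm w)"
    unfolding \<beta>_def \<phi>w
    by (cases "w = 0") (simp_all add: cinner_simps wu v_def cinner_self power2_eq_square)
  then have \<phi>_eq: "\<phi> = \<alpha> *\<^sub>C u + \<beta> *\<^sub>C v" using \<phi>w wv by simp
  \<comment> \<open>The form of normalisation shared by unit vectors and zero, so the degenerate
    case needs no separate treatment below.\<close>
  have vv: "cinner v v *\<^sub>C v = v"
    by (cases "w = 0") (simp_all add: v_def cinner_self norm_scaleC norm_inverse)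
  obtain Su where Su: "S u = Some Su" using u_dom by (auto simp: S_def)
  obtain S\<phi> where S\<phi>: "S \<phi> = Some S\<phi>" using \<phi>_dom by (auto simp: S_def)
  have "S w = Some (S\<phi> + (- \<alpha>) *\<^sub>C Su)"
    using SD(1)[OF S\<phi> SD(2)[OF Su, of "- \<alpha>"]] by (simp add: w_def scaleC_minus_left)
  then obtain Sv where Sv: "S v = Some Sv" unfolding v_def using SD(2) by blast
  have S_comb: "S (a *\<^sub>C u + b *\<^sub>C v) = Some (a *\<^sub>C Su + b *\<^sub>C Sv)" for a b
    by (rule SD(1)[OF SD(2)[OF Su] SD(2)[OF Sv]])
  have S\<phi>_eq: "S\<phi> = \<alpha> *\<^sub>C Su + \<beta> *\<^sub>C Sv" using S_comb[of \<alpha> \<beta>] S\<phi> by (simp flip: \<phi>_eq)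
  have r_eq: "r y = cinner (r u) y *\<^sub>C u + cinner (r v) y *\<^sub>C v" for y
  proof -
    define z where "z = r y - (cinner u (r y) *\<^sub>C u + cinner v (r y) *\<^sub>C v)"
    have uz: "cinner u z = 0" by (simp add: z_def cinner_simps uu uv)
    have "cinner v z = cinner v (r y) - cinner v (cinner v (r y) *\<^sub>C v)"
      by (simp add: z_def cinner_simps vu)
    also have "\<dots> = cinner (v - cinner v v *\<^sub>C v) (r y)"
      using cinner_commute[of v v] by (simp add: cinner_simps mult.commute)
    finally have vz: "cinner v z = 0" by (simp add: vv)
    have "cinner \<phi> z = 0" by (simp add: \<phi>_eq cinner_simps uz vz)
    then have "\<rho> z = 0" by (simp add: \<rho>_def mix_state_def uz)
    then have "cinner (r z) (r z) = 0" by (simp add: r_cinner)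
    then have rz: "r z = 0" by (simp add: cinner_self)
    have zu: "cinner z u = 0" and zv: "cinner z v = 0"
      using uz vz cinner_commute[of z u] cinner_commute[of z v] by simp_all
    have "cinner z (r y) = 0" by (simp add: r_sym[symmetric] rz)
    then have "cinner z z = 0" by (subst (2) z_def) (simp add: cinner_simps zu zv)
    then have "z = 0" by (simp add: cinner_self)
    then show ?thesis by (simp add: z_def r_sym)
  qed
  define k where "k e = cinner (r u) e *\<^sub>C Su + cinner (r v) e *\<^sub>C Sv" for e
  have K: "(S \<circ>\<^sub>m R) e = Some (k e)" for e
    using S_comb[of "cinner (r u) e" "cinner (r v) e"] R[of e] r_eq[of e]
    by (simp add: map_comp_Some_iff k_def)
  \<comment> \<open>Entries of \<open>\<rho>\<close> at \<open>u, v\<close> paired with the Gram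
    matrix of \<open>Su, Sv\<close>. Parseval collapses the sum over \<open>e\<close> to products
    such as \<open>cinner (r v) (r u)\<close>, and \<open>r_cinner\<close> then eliminates the
    root.\<close>
  define s where "s = cinner u (\<rho> u) * cinner Su Su + cinner v (\<rho> u) * cinner Su Sv +
    cinner u (\<rho> v) * cinner Sv Su + cinner v (\<rho> v) * cinner Sv Sv"
  have "((\<lambda>e. (cinner (r u) e * cinner e (r u)) * cinner Su Su + (cinner (r v) e * cinner e (r u)) * cinner Su Sv +
    (cinner (r u) e * cinner e (r v)) * cinner Sv Su + (cinner (r v) e * cinner e (r v)) * cinner Sv Sv)
    has_sum s) some_onb"
    unfolding s_def r_cinner[symmetric]
    by (intro has_sum_add has_sum_cmult_left some_onb_Parseval)
  moreover have "(cinner (r u) e * cinner e (r u)) * cinner Su Su + (cinner (r v) e * cinner e (r u)) * cinner Su Sv +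
    (cinner (r u) e * cinner e (r v)) * cinner Sv Su + (cinner (r v) e * cinner e (r v)) * cinner Sv Sv
    = of_real ((norm (k e))\<^sup>2)" for e
    unfolding cinner_self[symmetric] k_def
    by (simp add: cinner_simps cinner_commute[of e] algebra_simps)
  ultimately have sum: "((\<lambda>e. complex_of_real ((norm (k e))\<^sup>2)) has_sum s) some_onb" by simp
  have \<phi>u: "cinner \<phi> u = cnj \<alpha>" and \<phi>v: "cinner \<phi> v = cnj \<beta>"
    unfolding \<alpha>_def \<beta>_def by (rule cinner_commute)+
  have "s = (cinner Su Su + cinner S\<phi> S\<phi>) / 2"
    unfolding s_def \<rho>_def mix_state_def S\<phi>_eq
    by (simp add: cinner_simps uu uv vu \<phi>u \<phi>v \<alpha>_def[symmetric] \<beta>_def[symmetric] field_simps)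
  also have "\<dots> = of_real ((energy G u + energy G \<phi>) / 2)"
    using Su S\<phi> by (simp add: cinner_self energy_def S_def)
  finally have "((\<lambda>e. (norm (k e))\<^sup>2) has_sum (energy G u + energy G \<phi>) / 2) some_onb"
    using sum by (simp only: has_sum_of_real_iff)
  moreover have "dom (S \<circ>\<^sub>m R) = UNIV" using K by auto
  ultimately show ?thesis
    unfolding energy_trace_def Let_def \<rho>_def[symmetric] S_def[symmetric] R_def[symmetric]
    by (auto simp: K infsumI dest: has_sum_imp_summable)
qed

text \<open>By Cauchy--Schwarz \<open>\<parallel>h \<psi>\<parallel> \<ge> \<bar>\<langle>\<psi>, h \<psi>\<rangle>\<bar>\<close>, so the variance of \<open>h\<close> in the mixture is at least
  the variance of the fair coin with values \<open>\<langle>\<psi>, h \<psi>\<rangle>\<close> and \<open>\<langle>\<phi>, h \<phi>\<rangle>\<close>.\<close>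

lemma gamma_energy_ge_expect_diff:
  fixes G :: "'a::complex_hilbert \<rightharpoonup> 'a"
  assumes G: "positive_self_adjoint G" and h: "self_adjoint h"
    and dom: "\<psi> \<in> dom (op_sqrt G)" "\<phi> \<in> dom (op_sqrt G)" and unit: "norm \<psi> = 1" "norm \<phi> = 1"
    and E: "(energy G \<psi> + energy G \<phi>) / 2 \<le> E"
  shows "ereal (expect h \<psi> - expect h \<phi>) \<le> gamma_energy G E h"
proof -
  define \<rho> where "\<rho> = mix_state \<psi> \<phi>"
  define V where "V = Re (trace (\<rho> \<circ> h \<circ> h)) - (Re (trace (\<rho> \<circ> h)))\<^sup>2"
  have sq: "(expect h x)\<^sup>2 \<le> Re (cinner x (h (h x)))" if "norm x = 1" for x
  proof -
    have "\<bar>expect h x\<bar> \<le> norm (h x)"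
      using Re_cinner_le[of x "h x"] that by (simp add: expect_def)
    then have "(expect h x)\<^sup>2 \<le> (norm (h x))\<^sup>2" by (rule power2_le_iff_abs_le[THEN iffD2, rotated]) simp
    then show ?thesis by (simp add: power2_norm_eq_cinner self_adjointD[OF h])
  qed
  have tr: "trace (\<rho> \<circ> h) = (cinner \<psi> (h \<psi>) + cinner \<phi> (h \<phi>)) / 2"
    unfolding trace_def \<rho>_def o_def by (rule infsumI[OF mix_state_has_trace]) (rule self_adjointD[OF h])
  have tr2: "trace (\<rho> \<circ> h \<circ> h) = (cinner \<psi> (h (h \<psi>)) + cinner \<phi> (h (h \<phi>))) / 2"
    unfolding trace_def \<rho>_def o_def
    by (rule infsumI[OF mix_state_has_trace[where A = "\<lambda>x. h (h x)"]]) (simp add: self_adjointD[OF h])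
  have "V = (Re (cinner \<psi> (h (h \<psi>))) + Re (cinner \<phi> (h (h \<phi>)))) / 2 -
      ((expect h \<psi> + expect h \<phi>) / 2)\<^sup>2"
    by (simp add: V_def expect_def tr tr2)
  \<comment> \<open>With p, q the two expectations: (p^2 + q^2) / 2 - ((p + q) / 2)^2 = ((p - q) /
    2)^2.\<close>
  then have "((expect h \<psi> - expect h \<phi>) / 2)\<^sup>2 \<le> V"
    using sq[OF unit(1)] sq[OF unit(2)] by (simp add: power2_eq_square field_simps)
  then have "(expect h \<psi> - expect h \<phi>) / 2 \<le> sqrt V" by (rule real_le_rsqrt)
  then have "ereal (expect h \<psi> - expect h \<phi>) \<le> 2 * ereal (sqrt V)" by simp
  also have "\<dots> \<le> gamma_energy G E h"
    unfolding gamma_energy_def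
  proof (rule ereal_mult_left_mono)
    have "density_operator \<rho>" "energy_trace G \<rho> \<le> ereal E"
      using density_operator_mix_state[OF unit] energy_trace_mix_state[OF G dom unit(1)] E
      by (simp_all add: \<rho>_def)
    then show "ereal (sqrt V) \<le> (SUP \<rho>\<in>{\<rho>. density_operator \<rho> \<and> energy_trace G \<rho> \<le> ereal E}.
        ereal (sqrt (Re (trace (\<rho> \<circ> h \<circ> h)) - (Re (trace (\<rho> \<circ> h)))\<^sup>2)))"
      unfolding V_def by (intro SUP_upper) simp
  qed simp
  finally show ?thesis .
qed

lemma self_adjoint_icomm:
  assumes a: "self_adjoint a" and b: "self_adjoint b"
  shows "self_adjoint (icomm a b)"
proof -
  note alin = self_adjoint_linearD[OF a] and blin = self_adjoint_linearD[OF b]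
  have "bounded_linear (icomm a b)" unfolding icomm_def
    by (intro bounded_linear_compose[OF bounded_linear_scaleC] bounded_linear_sub
        bounded_linear_compose[OF alin(1) blin(1)] bounded_linear_compose[OF blin(1) alin(1)])
  moreover have "cinner (icomm a b x) y = cinner x (icomm a b y)" for x y
    by (simp add: icomm_def cinner_simps self_adjointD[OF a] self_adjointD[OF b] algebra_simps)
  ultimately show ?thesis
    by (simp add: self_adjoint_def bounded_clinear_def icomm_def alin blin scaleC_diff_right
        scaleC_scaleC mult.commute)
qed

theorem proposition4p15:
  fixes G :: "'a::complex_hilbert \<rightharpoonup> 'a"
    and M N :: "('a \<Rightarrow> 'a) set"
  assumes "\<exists>x::'a. x \<noteq> 0"
    and "positive_self_adjoint G"
    and "von_neumann_algebra M" and "von_neumann_algebra N"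
  shows "(\<forall>(h::'a \<Rightarrow> 'a) (\<delta>::real). self_adjoint h \<longrightarrow> \<delta> > 0 \<longrightarrow>
            edge_energy G h \<delta> < \<infinity> \<and>
            (\<forall>E::real. ereal E > edge_energy G h \<delta> \<longrightarrow>
               gamma_energy G E h \<ge> ereal (diameter (spectrum h) - 2 * \<delta>)))
       \<and> (\<forall>\<epsilon>::real. \<epsilon> > 0 \<longrightarrow>
            (\<forall>E::real. ereal E > edge_threshold G M N \<epsilon> \<longrightarrow>
               Gamma_energy G E M N > Gamma_cb M N - ereal \<epsilon>))"
proof -
  note SD = unbounded_self_adjointD[OF positive_self_adjointD(1)[OF op_sqrt(1)[OF assms(2)]]]
  have scale: "c *\<^sub>C x \<in> dom (op_sqrt G)" if "x \<in> dom (op_sqrt G)" for c x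
    using that SD(2) by blast
  have finite: "edge_energy G h \<delta> < \<infinity>" if h: "self_adjoint h" and \<delta>: "\<delta> > 0" for h :: "'a \<Rightarrow> 'a" and \<delta>
  proof -
    obtain \<psi>\<^sub>p where p: "\<psi>\<^sub>p \<in> dom (op_sqrt G)" "norm \<psi>\<^sub>p = 1" "expect h \<psi>\<^sub>p \<ge> lambda_plus h - \<delta>"
      by (rule lambda_plus_approx_dense[OF h assms(1) \<delta> SD(3) scale])
    \<comment> \<open>A near-minimiser of \<open>h\<close> is a near-maximiser of -h.\<close>
    obtain \<psi>\<^sub>m where m: "\<psi>\<^sub>m \<in> dom (op_sqrt G)" "norm \<psi>\<^sub>m = 1"
      and "expect (\<lambda>x. - h x) \<psi>\<^sub>m \<ge> lambda_plus (\<lambda>x. - h x) - \<delta>"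
      by (rule lambda_plus_approx_dense[OF self_adjoint_uminus[OF h] assms(1) \<delta> SD(3) scale])
    then have "expect h \<psi>\<^sub>m \<le> lambda_minus h + \<delta>"
      by (simp add: lambda_minus_eq[OF h assms(1)] expect_def cinner_minus_right)
    with p m have "edge_energy G h \<delta> \<le> ereal ((energy G \<psi>\<^sub>p + energy G \<psi>\<^sub>m) / 2)"
      unfolding edge_energy_def by (intro Inf_lower) blast
    then show ?thesis by (rule le_less_trans) simp
  qed
  have gamma: "ereal (diameter (spectrum h) - 2 * \<delta>) \<le> gamma_energy G E h"
    if h: "self_adjoint h" and E: "ereal E > edge_energy G h \<delta>" for h :: "'a \<Rightarrow> 'a" and \<delta> E
  proof -
    obtain \<psi>\<^sub>p \<psi>\<^sub>m where \<psi>: "\<psi>\<^sub>p \<in> dom (op_sqrt G)" "\<psi>\<^sub>m \<in> dom (op_sqrt G)" "norm \<psi>\<^sub>p = 1" "norm \<psi>\<^sub>m = 1"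
      "expect h \<psi>\<^sub>p \<ge> lambda_plus h - \<delta>" "expect h \<psi>\<^sub>m \<le> lambda_minus h + \<delta>"
      and "ereal ((energy G \<psi>\<^sub>p + energy G \<psi>\<^sub>m) / 2) < ereal E"
      using E unfolding edge_energy_def Inf_less_iff by blast
    then have "ereal (expect h \<psi>\<^sub>p - expect h \<psi>\<^sub>m) \<le> gamma_energy G E h"
      by (intro gamma_energy_ge_expect_diff assms(2) h) auto
    moreover have "diameter (spectrum h) - 2 * \<delta> \<le> expect h \<psi>\<^sub>p - expect h \<psi>\<^sub>m"
      using \<psi>(5,6) diameter_spectrum_le[OF h assms(1)] by linarith
    ultimately show ?thesis by (meson ereal_less_eq(3) order_trans)
  qed
  have "Gamma_energy G E M N > Gamma_cb M N - ereal \<epsilon>"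
    if E: "ereal E > edge_threshold G M N \<epsilon>" for E \<epsilon>
  proof -
    obtain a b where ab: "a \<in> sa_contractions M" "b \<in> sa_contractions N"
      and diam: "ereal (diameter (spectrum (icomm a b))) > Gamma_cb M N - ereal (\<epsilon> / 3)"
      and E': "edge_energy G (icomm a b) (\<epsilon> / 3) < ereal E"
      using E unfolding edge_threshold_def Inf_less_iff by blast
    \<comment> \<open>The diameter is a real number, so \<open>diam\<close> rules out an infinite
      \<open>Gamma_cb M N\<close>; its strictness is the source of the strict inequality in the
      conclusion.\<close>
    have "Gamma_cb M N - ereal \<epsilon> < ereal (diameter (spectrum (icomm a b)) - 2 * (\<epsilon> / 3))"
      using diam by (cases "Gamma_cb M N") auto
    also have "\<dots> \<le> gamma_energy G E (icomm a b)"
      using ab by (intro gamma[OF self_adjoint_icomm E']) (auto simp: sa_contractions_def)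
    also have "\<dots> \<le> Gamma_energy G E M N"
      unfolding Gamma_energy_def using ab by (intro SUP_upper2[of "(a, b)"]) auto
    finally show ?thesis .
  qed
  with finite gamma show ?thesis by blast
qed

end
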